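(* Let $G$ be a V-graph. Then the vertex connectivity of $G$ is exactly four.
   Context: Consider a finite collection of $n \ge 3$ simple closed curves in the plane whose union is topologically connected, and which lie in general position: they intersect in finitely many points, at most two curves pass through any point, and every intersection is transverse (curves cross where they meet; no tangencies). The associated plane graph has as vertices the intersection points and as edges the curve segments between consecutive intersection points along each curve; it is a 4-regular plane graph. The collection satisfies the unique face incidence (UFI) property if each curve is incident to any given face at most once, i.e., the part of the boundary of each face lying on a given curve is empty or a single arc between intersection points incident to that face. A V-graph is the graph associated with such a collection (at least three curves, topologically connected, general position) satisfying the UFI property. *)

theory Defs
  imports "HOL-Analysis.Analysis" "Graph_Theory.Graph_Theory"
begin

text \<open>
  The plane is \<^typ>\<open>complex\<close>; a curve is identified with its point set.
  The name \<open>connected\<close> exists both for topological spaces and for graphs, so it is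
  always written in qualified form.
\<close>

definition simple_closed_curve :: "complex set \<Rightarrow> bool" where
  "simple_closed_curve C \<longleftrightarrow>
     (\<exists>g. simple_path g \<and> pathfinish g = pathstart g \<and> path_image g = C)"

text \<open>
  Topological transversality: near \<open>p\<close>, after a local homeomorphism, the two curves are the
  two coordinate axes. No smoothness is assumed of the curves.
\<close>

definition cross_at :: "complex set \<Rightarrow> complex set \<Rightarrow> complex \<Rightarrow> bool" where
  "cross_at C D p \<longleftrightarrow>
     (\<exists>U f g. open U \<and> p \<in> U \<and> homeomorphism U (ball 0 1) f g \<and> f p = 0 \<and>
        f ` (C \<inter> U) = {z \<in> ball 0 1. Im z = 0} \<and>
        f ` (D \<inter> U) = {z \<in> ball 0 1. Re z = 0})"

definition crossings :: "complex set set \<Rightarrow> complex set" where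
  "crossings \<C> = {p. \<exists>C\<in>\<C>. \<exists>D\<in>\<C>. C \<noteq> D \<and> p \<in> C \<inter> D}"

definition general_position :: "complex set set \<Rightarrow> bool" where
  "general_position \<C> \<longleftrightarrow>
     finite (crossings \<C>) \<and>
     (\<forall>p. card {C \<in> \<C>. p \<in> C} \<le> 2) \<and>
     (\<forall>C\<in>\<C>. \<forall>D\<in>\<C>. C \<noteq> D \<longrightarrow> (\<forall>p \<in> C \<inter> D. cross_at C D p))"

definition curve_system :: "complex set set \<Rightarrow> bool" where
  "curve_system \<C> \<longleftrightarrow>
     finite \<C> \<and> 3 \<le> card \<C> \<and> (\<forall>C\<in>\<C>. simple_closed_curve C) \<and>
     Topological_Spaces.connected (\<Union>\<C>) \<and> general_position \<C>"

text \<open>The faces include the unbounded one.\<close>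

definition faces :: "complex set set \<Rightarrow> complex set set" where
  "faces \<C> = components (- \<Union>\<C>)"

definition unique_face_incidence :: "complex set set \<Rightarrow> bool" where
  "unique_face_incidence \<C> \<longleftrightarrow>
     (\<forall>F \<in> faces \<C>. \<forall>C \<in> \<C>.
        frontier F \<inter> C = {} \<or>
        (\<exists>g. arc g \<and> path_image g = frontier F \<inter> C \<and>
             pathstart g \<in> crossings \<C> \<and> pathfinish g \<in> crossings \<C>))"

text \<open>The open segments into which the crossings divide each curve.\<close>

definition segments :: "complex set set \<Rightarrow> complex set set" where
  "segments \<C> = (\<Union>C\<in>\<C>. components (C - crossings \<C>))"

text \<open>
  The associated graph is a multigraph, rendered as a symmetric digraph: a segment \<open>e\<close> with end
  points \<open>u\<close> and \<open>v\<close> gives the two arcs \<open>(u, e, v)\<close> and \<open>(v, e, u)\<close>, so that distinct segments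
  with the same end points remain distinct edges.
\<close>

definition curve_graph ::
  "complex set set \<Rightarrow> (complex, complex \<times> complex set \<times> complex) pre_digraph" where
  "curve_graph \<C> =
     \<lparr> verts = crossings \<C>,
       arcs = {(u, e, v). e \<in> segments \<C> \<and> closure e \<inter> crossings \<C> = {u, v}},
       tail = (\<lambda>(u, e, v). u),
       head = (\<lambda>(u, e, v). v) \<rparr>"

definition V_graph :: "(complex, complex \<times> complex set \<times> complex) pre_digraph \<Rightarrow> bool" where
  "V_graph G \<longleftrightarrow> (\<exists>\<C>. curve_system \<C> \<and> unique_face_incidence \<C> \<and> G = curve_graph \<C>)"

text \<open>
  For finite graphs: the least number of vertices whose deletion disconnects the graph or leaves
  at most one vertex (so a complete graph on \<open>n\<close> vertices has connectivity \<open>n - 1\<close>).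
\<close>

definition vertex_connectivity :: "('a, 'b) pre_digraph \<Rightarrow> nat" where
  "vertex_connectivity G =
     (LEAST k. \<exists>S. S \<subseteq> verts G \<and> finite S \<and> card S = k \<and>
        (\<not> Digraph_Component.connected (G \<restriction> (verts G - S)) \<or> (\<exists>v. verts G - S \<subseteq> {v})))"

end

theory Submission
  imports Defs
begin

text \<open>
  Deleting the at most four neighbours of a vertex isolates it, so the point is that no set \<open>S\<close> of at
  most three vertices separates. Take a minimal separating \<open>S\<close> with sides \<open>A\<close>, \<open>B\<close> and colour every
  edge by the side it meets. Colours change only at \<open>S\<close>, and by the handshake lemma they change an even
  number of times along each curve and around each face. By UFI, two vertices of a face that lie on
  a common curve are joined by the edge of this curve on that face; hence a face at which both a
  vertex \<open>s\<close> and another vertex of \<open>S\<close> see both colours severely restricts the edges at \<open>s\<close>. Since two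
  curves cross an even number of times, a curve that crosses another one at \<open>s\<close> does so again. A case
  analysis on which of the two curves through a vertex of \<open>S\<close> change colour there refutes every
  configuration.

  The incidences needed for this come from the Jordan curve theorem: the inside and the outside of
  the two curves through a crossing tell its four quadrants, hence the faces at it, apart.
\<close>

section \<open>Separations of combinatorial curve arrangements\<close>

text \<open>The obstacle is the lack of local information: \<open>cross_at\<close> gives coordinates
  at crossings only, and between crossings a curve is merely continuous, so how a face follows a
  segment cannot be read off locally. UFI fills this gap. The arc in which a face meets a curve ends
  at crossings, so it consists of whole segments; a face occupies only one quadrant at a crossing,
  so the arc cannot continue past one. Hence a face has at most one edge on each curve, the form in
  which UFI is used. Face boundaries then need no cyclic order: a vertex of a face has exactly two
  edges there, one on each of its curves, and the parity of colour changes is the handshake lemma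
  for the edges of one colour. The same lemma, for the segments of \<open>C\<close> inside
  \<open>D\<close>, shows that \<open>C\<close> and \<open>D\<close> cross an even number of times.

  The bound three works as follows: every mixed face at \<open>s\<close>, every further colour
  change on a curve and every repeated crossing of unicoloured curves demands another vertex of
  \<open>S\<close>, and at most two are available besides \<open>s\<close>.\<close>

lemma even_card_odd_degree:
  fixes ends :: "'e \<Rightarrow> 'v set"
  assumes "finite M" "finite V" and ends: "\<And>e. e \<in> M \<Longrightarrow> card (ends e) = 2 \<and> ends e \<subseteq> V"
  shows "even (card {p \<in> V. odd (card {e \<in> M. p \<in> ends e})})"
proof -
  have "{p \<in> V. p \<in> ends e} = ends e" if "e \<in> M" for e
    using ends that by blast
  then have "(\<Sum>p\<in>V. card {e \<in> M. p \<in> ends e}) = 2 * card M"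
    using assms by (intro sum_multicount) auto
  then have "even (\<Sum>p\<in>V. card {e \<in> M. p \<in> ends e})"
    by simp
  then show ?thesis
    using \<open>finite V\<close> by (simp add: even_sum_iff)
qed

text \<open>Planarity survives only in \<open>even_crossings\<close>, \<open>corner\<close>,
  \<open>bd_turn\<close> and \<open>ufi\<close>. A face is known only by its edge set
  \<open>bd F\<close>, and no set of faces is singled out: in the application the edge set is empty
  for arguments that are not faces.\<close>

locale curve_arrangement =
  fixes V :: "'v set" and K :: "'c set" and pts :: "'c \<Rightarrow> 'v set"
    and E :: "'c \<Rightarrow> 'e set" and ends :: "'e \<Rightarrow> 'v set" and bd :: "'f \<Rightarrow> 'e set"
  assumes finite_V: "finite V" and finite_K: "finite K" and card_K: "3 \<le> card K"
    and finite_E: "C \<in> K \<Longrightarrow> finite (E C)"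
    and E_disjoint: "C \<in> K \<Longrightarrow> D \<in> K \<Longrightarrow> C \<noteq> D \<Longrightarrow> E C \<inter> E D = {}"
    and card_ends: "C \<in> K \<Longrightarrow> e \<in> E C \<Longrightarrow> card (ends e) = 2"
    and ends_subset: "C \<in> K \<Longrightarrow> e \<in> E C \<Longrightarrow> ends e \<subseteq> pts C"
    and pts_subset: "C \<in> K \<Longrightarrow> pts C \<subseteq> V"
    and degree: "C \<in> K \<Longrightarrow> p \<in> pts C \<Longrightarrow> card {e \<in> E C. p \<in> ends e} = 2"
    and two_curves: "p \<in> V \<Longrightarrow> card {C \<in> K. p \<in> pts C} = 2"
    and even_crossings: "C \<in> K \<Longrightarrow> D \<in> K \<Longrightarrow> C \<noteq> D \<Longrightarrow> even (card (pts C \<inter> pts D))"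
    and curve_connected: "\<And>X. C \<in> K \<Longrightarrow> X \<subseteq> E C \<Longrightarrow> X \<noteq> {} \<Longrightarrow>
      (\<And>p e e'. e \<in> X \<Longrightarrow> e' \<in> E C \<Longrightarrow> p \<in> ends e \<Longrightarrow> p \<in> ends e' \<Longrightarrow> e' \<in> X) \<Longrightarrow> X = E C"
    and system_connected: "\<And>X. X \<subseteq> K \<Longrightarrow> X \<noteq> {} \<Longrightarrow> X \<noteq> K \<Longrightarrow>
      \<exists>C\<in>X. \<exists>D\<in>K - X. pts C \<inter> pts D \<noteq> {}"
    and corner: "C \<in> K \<Longrightarrow> D \<in> K \<Longrightarrow> C \<noteq> D \<Longrightarrow> c \<in> E C \<Longrightarrow> d \<in> E D \<Longrightarrow>
      p \<in> ends c \<Longrightarrow> p \<in> ends d \<Longrightarrow> \<exists>F. c \<in> bd F \<and> d \<in> bd F"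
    and bd_subset: "bd F \<subseteq> (\<Union>C\<in>K. E C)"
    and bd_turn: "C \<in> K \<Longrightarrow> D \<in> K \<Longrightarrow> C \<noteq> D \<Longrightarrow> c \<in> E C \<Longrightarrow> c \<in> bd F \<Longrightarrow> p \<in> ends c \<Longrightarrow>
      p \<in> pts D \<Longrightarrow> \<exists>d\<in>E D. d \<in> bd F \<and> p \<in> ends d"
    and ufi: "C \<in> K \<Longrightarrow> e \<in> E C \<Longrightarrow> e' \<in> E C \<Longrightarrow> e \<in> bd F \<Longrightarrow> e' \<in> bd F \<Longrightarrow> e = e'"
begin

section \<open>Incidences and numbers of vertices\<close>

lemma curves_at:
  assumes "p \<in> V"
  obtains C D where "C \<in> K" "D \<in> K" "C \<noteq> D" "p \<in> pts C" "p \<in> pts D"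
    "\<forall>X\<in>K. p \<in> pts X \<longrightarrow> X = C \<or> X = D"
proof -
  obtain C D where "{C \<in> K. p \<in> pts C} = {C, D}" "C \<noteq> D"
    using two_curves[OF assms] by (auto simp: card_2_iff)
  then show thesis
    using that[of C D] by blast
qed

lemma other_curve:
  assumes "C \<in> K" "p \<in> pts C"
  obtains D where "D \<in> K" "C \<noteq> D" "p \<in> pts D" "\<forall>X\<in>K. p \<in> pts X \<longrightarrow> X = C \<or> X = D"
proof -
  have "p \<in> V" using assms pts_subset by blast
  then obtain X Y where XY: "X \<in> K" "Y \<in> K" "X \<noteq> Y" "p \<in> pts X" "p \<in> pts Y"
    and only: "\<forall>Z\<in>K. p \<in> pts Z \<longrightarrow> Z = X \<or> Z = Y"
    by (rule curves_at)
  show thesis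
  proof (cases "C = X")
    case True
    then show thesis using that[of Y] XY only by blast
  next
    case False
    then show thesis using that[of X] XY only assms by blast
  qed
qed

lemma at_most_two_curves:
  assumes "C \<in> K" "D \<in> K" "X \<in> K" "p \<in> pts C" "p \<in> pts D" "p \<in> pts X" "C \<noteq> D"
  shows "X = C \<or> X = D"
  using curves_at[of p] assms pts_subset by (metis subsetD)

lemma edges_at:
  assumes "C \<in> K" "p \<in> pts C"
  obtains c c' where "c \<noteq> c'" "c \<in> E C" "c' \<in> E C" "p \<in> ends c" "p \<in> ends c'"
    "{e \<in> E C. p \<in> ends e} = {c, c'}"
proof -
  obtain c c' where "{e \<in> E C. p \<in> ends e} = {c, c'}" "c \<noteq> c'"
    using degree[OF assms] by (auto simp: card_2_iff)
  then show thesis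
    using that[of c c'] by blast
qed

lemma meets_again:
  assumes "C \<in> K" "D \<in> K" "C \<noteq> D" "p \<in> pts C" "p \<in> pts D"
  obtains q where "q \<noteq> p" "q \<in> pts C" "q \<in> pts D"
proof -
  have "pts C \<inter> pts D \<noteq> {p}"
    using even_crossings[OF assms(1-3)] by auto
  then show thesis
    using assms that by blast
qed

text \<open>The two edges use up the degree two of \<open>C\<close> at both ends, so they are closed
  under adjacency and \<open>curve_connected\<close> makes them all of \<open>C\<close>.\<close>

lemma parallel_edges:
  assumes "C \<in> K" "c \<in> E C" "c' \<in> E C" "c \<noteq> c'" "{p, q} \<subseteq> ends c" "{p, q} \<subseteq> ends c'" "p \<noteq> q"
  shows "pts C = {p, q}"
proof -
  have fin: "finite (ends c)" "finite (ends c')"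
    using card_ends assms by (auto intro!: card_ge_0_finite)
  have pq: "ends c = {p, q}" "ends c' = {p, q}"
    using card_subset_eq[OF fin(1), of "{p, q}"] card_subset_eq[OF fin(2), of "{p, q}"] assms card_ends
    by auto
  have pts: "p \<in> pts C" "q \<in> pts C"
    using assms ends_subset pq by blast+
  have at: "{e \<in> E C. r \<in> ends e} = {c, c'}" if "r \<in> {p, q}" for r
  proof -
    have "r \<in> pts C" using that pts by auto
    then obtain a b where "{e \<in> E C. r \<in> ends e} = {a, b}"
      using edges_at[OF assms(1)] by metis
    moreover have "c \<in> {e \<in> E C. r \<in> ends e}" "c' \<in> {e \<in> E C. r \<in> ends e}"
      using that assms by auto
    ultimately show ?thesis using assms(4) by auto
  qed
  have "{c, c'} = E C"
    using assms at pq by (intro curve_connected[OF assms(1)]) blast+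
  show ?thesis
  proof
    show "pts C \<subseteq> {p, q}"
    proof
      fix r assume "r \<in> pts C"
      then obtain e where "e \<in> E C" "r \<in> ends e"
        using edges_at[OF assms(1)] by metis
      then show "r \<in> {p, q}"
        using \<open>{c, c'} = E C\<close> pq by auto
    qed
  qed (use pts in auto)
qed

text \<open>At \<open>q\<close> the face turns into an edge of \<open>C\<close> by
  \<open>bd_turn\<close>, and \<open>ufi\<close> identifies that edge with \<open>c\<close>. Every
  later use of UFI goes through this fact.\<close>

lemma face_edge:
  assumes C: "C \<in> K" "c \<in> E C" "c \<in> bd F" and q: "q \<in> pts C" "e \<in> bd F" "q \<in> ends e"
  shows "q \<in> ends c"
proof -
  obtain D where D: "D \<in> K" "e \<in> E D"
    using bd_subset q by blast
  show ?thesis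
  proof (cases "C = D")
    case True
    then show ?thesis using ufi C D q by blast
  next
    case False
    then obtain d where "d \<in> E C" "d \<in> bd F" "q \<in> ends d"
      using bd_turn[of D C e F q] C D q by blast
    then show ?thesis using ufi C by blast
  qed
qed

text \<open>If \<open>C\<close> had only the vertices \<open>p\<close> and \<open>q\<close>, an edge
  of \<open>D\<close> at \<open>p\<close> would share a face with an edge of \<open>C\<close> from
  \<open>p\<close> to \<open>q\<close>, hence also end at \<open>q\<close>. Then \<open>D\<close>
  has no further vertices either, and \<open>C\<close> and \<open>D\<close> are cut off from the
  third curve.\<close>

lemma more_than_two_vertices:
  assumes "C \<in> K"
  shows "card (pts C) > 2"
proof (rule ccontr)
  assume "\<not> card (pts C) > 2"
  have "{C} \<noteq> K" using card_K by auto
  then obtain D p where D: "D \<in> K" "D \<noteq> C" and p: "p \<in> pts C" "p \<in> pts D"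
    using system_connected[of "{C}"] assms by blast
  obtain q where q: "q \<noteq> p" "q \<in> pts C" "q \<in> pts D"
    using meets_again[of C D p] assms D p by auto
  have "finite (pts C)"
    using pts_subset assms finite_V finite_subset by blast
  then have C: "pts C = {p, q}"
    using \<open>\<not> card (pts C) > 2\<close> p q card_seteq[of "pts C" "{p, q}"] by auto
  have cq: "q \<in> ends c" if "c \<in> E C" for c
  proof -
    have "finite (ends c)" "card (ends c) = 2" "ends c \<subseteq> {p, q}"
      using card_ends[OF assms that] ends_subset[OF assms that] C by (auto intro!: card_ge_0_finite)
    then show ?thesis using q card_seteq[of "{p, q}" "ends c"] by auto
  qed
  obtain c where c: "c \<in> E C" "p \<in> ends c"
    using edges_at[OF assms p(1)] by metis
  obtain d d' where d: "d \<noteq> d'" "d \<in> E D" "d' \<in> E D" "p \<in> ends d" "p \<in> ends d'"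
    using edges_at[OF D(1) p(2)] by metis
  have "q \<in> ends x" if x: "x \<in> E D" "p \<in> ends x" for x
  proof -
    obtain F where "c \<in> bd F" "x \<in> bd F"
      using corner[of C D c x p] assms D c x by blast
    then show ?thesis
      using face_edge[of D x F q c] D x q cq c by auto
  qed
  then have DD: "pts D = {p, q}"
    using parallel_edges[of D d d' p q] D d q by auto
  have "{C, D} \<noteq> K"
    using card_K by (metis card_2_iff D(2) numeral_le_iff semiring_norm(77) Suc_eq_plus1 eval_nat_numeral(3) not_less_eq_eq order_refl)
  then obtain Z Y where "Z \<in> {C, D}" "Y \<in> K - {C, D}" "pts Z \<inter> pts Y \<noteq> {}"
    using system_connected[of "{C, D}"] assms D by blast
  then have "Y \<in> K - {C, D}" "p \<in> pts Y \<or> q \<in> pts Y"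
    using C DD by auto
  then show False
    using at_most_two_curves[of C D Y] assms D p q by blast
qed

lemma pts_Union:
  assumes "C \<in> K"
  shows "pts C = (\<Union>D\<in>K - {C}. pts C \<inter> pts D)"
proof -
  have "\<exists>D\<in>K - {C}. p \<in> pts D" if "p \<in> pts C" for p
    using curves_at[of p] pts_subset assms that by (metis Diff_iff singletonD subsetD)
  then show ?thesis by blast
qed

text \<open>The other curves share out the vertices of \<open>C\<close>, an even number each, so
  more than two means at least four.\<close>

lemma four_vertices:
  assumes "C \<in> K"
  shows "card (pts C) \<ge> 4"
proof -
  have fin: "finite (pts X)" if "X \<in> K" for X
    using finite_subset[OF pts_subset finite_V] that by blast
  have "card (pts C) = card (\<Union>D\<in>K - {C}. pts C \<inter> pts D)"
    using pts_Union[OF assms] by simp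
  also have "\<dots> = (\<Sum>D\<in>K - {C}. card (pts C \<inter> pts D))"
  proof (rule card_UN_disjoint)
    show "\<forall>D\<in>K - {C}. \<forall>X\<in>K - {C}. D \<noteq> X \<longrightarrow> pts C \<inter> pts D \<inter> (pts C \<inter> pts X) = {}"
      using at_most_two_curves assms by blast
  qed (use finite_K fin assms in auto)
  also have "even \<dots>"
    using even_crossings assms by (intro dvd_sum) auto
  finally have "even (card (pts C))" .
  then show ?thesis
    using more_than_two_vertices[OF assms] by presburger
qed

text \<open>Of three curves one misses \<open>p\<close>, and it has four vertices of its own.
  Consequently deleting three vertices always leaves at least two, and the degenerate alternative in
  \<open>vertex_connectivity\<close> cannot occur for small sets.\<close>

lemma five_vertices: "card V \<ge> 5"
proof -
  obtain C where C: "C \<in> K" using card_K by fastforce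
  have "pts C \<noteq> {}"
    using four_vertices[OF C] by auto
  then obtain p where p: "p \<in> V"
    using pts_subset[OF C] by blast
  have "\<not> K \<subseteq> {X \<in> K. p \<in> pts X}"
    using two_curves[OF p] card_K card_mono[of "{X \<in> K. p \<in> pts X}" K] finite_K by auto
  then obtain D where D: "D \<in> K" "p \<notin> pts D"
    by blast
  have "finite (pts D)"
    using finite_subset[OF pts_subset finite_V] D by blast
  then have "card (insert p (pts D)) \<ge> 5"
    using four_vertices[OF D(1)] D by simp
  then show ?thesis
    using card_mono[OF finite_V, of "insert p (pts D)"] p pts_subset[OF D(1)] by simp
qed

end

text \<open>\<open>A\<close> and \<open>B\<close> need not be connected. Minimality is used only in
  the form that every vertex of \<open>S\<close> has an edge to each side.\<close>

locale minimal_separation = curve_arrangement V K pts E ends bd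
  for V :: "'v set" and K :: "'c set" and pts E and ends :: "'e \<Rightarrow> 'v set" and bd :: "'f \<Rightarrow> 'e set" +
  fixes S A B :: "'v set"
  assumes S: "S \<subseteq> V" "card S \<le> 3" and AB: "V - S = A \<union> B" "A \<inter> B = {}"
    and nonempty: "A \<noteq> {}" "B \<noteq> {}"
    and separated: "C \<in> K \<Longrightarrow> e \<in> E C \<Longrightarrow> ends e \<inter> A \<noteq> {} \<Longrightarrow> ends e \<inter> B = {}"
    and minimal_A: "s \<in> S \<Longrightarrow> \<exists>C\<in>K. \<exists>e\<in>E C. s \<in> ends e \<and> ends e \<inter> A \<noteq> {}"
    and minimal_B: "s \<in> S \<Longrightarrow> \<exists>C\<in>K. \<exists>e\<in>E C. s \<in> ends e \<and> ends e \<inter> B \<noteq> {}"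
begin

text \<open>Edges with both ends in \<open>S\<close> get the colour of the edges at \<open>A\<close>.\<close>

definition col :: "'e \<Rightarrow> bool" where
  "col e \<longleftrightarrow> ends e \<inter> B = {}"

definition chg :: "'v \<Rightarrow> 'c \<Rightarrow> bool" where
  "chg s C \<longleftrightarrow> (\<exists>e\<in>E C. \<exists>e'\<in>E C. s \<in> ends e \<and> s \<in> ends e' \<and> col e \<noteq> col e')"

definition mix :: "'v \<Rightarrow> 'f \<Rightarrow> bool" where
  "mix s F \<longleftrightarrow> (\<exists>e\<in>bd F. \<exists>e'\<in>bd F. s \<in> ends e \<and> s \<in> ends e' \<and> col e \<noteq> col e')"

section \<open>Parity of colour changes\<close>

lemma same_col:
  assumes "C \<in> K" "D \<in> K" "e \<in> E C" "e' \<in> E D" "p \<in> ends e" "p \<in> ends e'" "p \<notin> S"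
  shows "col e = col e'"
proof -
  have "p \<in> V - S" using assms ends_subset pts_subset by blast
  then show ?thesis using AB(1) separated assms unfolding col_def by blast
qed

lemma chg_pts: "C \<in> K \<Longrightarrow> chg s C \<Longrightarrow> s \<in> pts C"
  and chg_S: "C \<in> K \<Longrightarrow> chg s C \<Longrightarrow> s \<in> S"
  unfolding chg_def using same_col ends_subset by blast+

lemma mix_S: "mix s F \<Longrightarrow> s \<in> S"
  unfolding mix_def using same_col bd_subset by blast

text \<open>Translates the odd degrees of the handshake lemma, applied to the edges of one colour,
  into colour changes.\<close>

lemma odd_col_iff:
  assumes "{e \<in> M. p \<in> ends e} = {c, c'}" "c \<noteq> c'"
  shows "odd (card {e \<in> {e \<in> M. col e}. p \<in> ends e}) \<longleftrightarrow> col c \<noteq> col c'"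
proof -
  have "{e \<in> {e \<in> M. col e}. p \<in> ends e} = {e \<in> {c, c'}. col e}"
    using assms by blast
  also have "\<dots> = (if col c then {c} else {}) \<union> (if col c' then {c'} else {})"
    by auto
  finally show ?thesis using assms(2) by (auto simp: card_insert_if)
qed

lemma even_chg:
  assumes "C \<in> K"
  shows "even (card {p. chg p C})"
proof -
  have "odd (card {e \<in> {e \<in> E C. col e}. p \<in> ends e}) \<longleftrightarrow> chg p C" if p: "p \<in> V" for p
  proof (cases "p \<in> pts C")
    case True
    then obtain c c' where c: "c \<noteq> c'" "{e \<in> E C. p \<in> ends e} = {c, c'}"
      using edges_at[OF assms] by metis
    have "chg p C \<longleftrightarrow> (\<exists>e\<in>{e \<in> E C. p \<in> ends e}. \<exists>e'\<in>{e \<in> E C. p \<in> ends e}. col e \<noteq> col e')"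
      unfolding chg_def by blast
    then show ?thesis
      using odd_col_iff[OF c(2,1)] unfolding c(2) by auto
  next
    case False
    then have "{e \<in> {e \<in> E C. col e}. p \<in> ends e} = {}"
      using ends_subset assms by blast
    then show ?thesis
      using False chg_pts[OF assms] by (metis card.empty even_zero)
  qed
  then have "{p \<in> V. odd (card {e \<in> {e \<in> E C. col e}. p \<in> ends e})} = {p. chg p C}"
    using chg_S[OF assms] S by blast
  moreover have "card (ends e) = 2 \<and> ends e \<subseteq> V" if "e \<in> E C" for e
    using that card_ends ends_subset pts_subset assms by blast
  ultimately show ?thesis
    using even_card_odd_degree[of "{e \<in> E C. col e}" V ends] finite_E[OF assms] finite_V by auto
qed

lemma chg_other:
  assumes "C \<in> K" "chg s C"
  obtains t where "t \<noteq> s" "chg t C"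
proof -
  have "{p. chg p C} \<noteq> {s}" using even_chg[OF assms(1)] by auto
  then show thesis using assms that by blast
qed

text \<open>A vertex of \<open>F\<close> has exactly two edges in \<open>bd F\<close>: some edge
  \<open>e\<close> and the edge \<open>d\<close> to which the boundary turns; \<open>ufi\<close>
  excludes others. So the handshake lemma applies to \<open>bd F\<close> as it does to a
  curve.\<close>

lemma mix_other:
  assumes "mix s F"
  obtains t where "t \<noteq> s" "mix t F"
proof -
  have "odd (card {e \<in> {e \<in> bd F. col e}. p \<in> ends e}) \<longleftrightarrow> mix p F" if p: "p \<in> V" for p
  proof (cases "\<exists>e\<in>bd F. p \<in> ends e")
    case True
    then obtain e C D where e: "e \<in> bd F" "p \<in> ends e" "e \<in> E C" "C \<in> K" and
      D: "D \<in> K" "C \<noteq> D" "p \<in> pts D" and only: "\<forall>X\<in>K. p \<in> pts X \<longrightarrow> X = C \<or> X = D"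
      using bd_subset curves_at[OF p] ends_subset by (smt (verit) UN_E subsetD)
    then obtain d where d: "d \<in> E D" "d \<in> bd F" "p \<in> ends d"
      using bd_turn by blast
    have "x = e \<or> x = d" if "x \<in> bd F" "p \<in> ends x" for x
      using that bd_subset only ufi e d D ends_subset by (smt (verit) UN_E subsetD)
    then have at: "{x \<in> bd F. p \<in> ends x} = {e, d}"
      using e d by blast
    have "e \<noteq> d" using E_disjoint e d D by blast
    moreover have "mix p F \<longleftrightarrow> (\<exists>e\<in>{x \<in> bd F. p \<in> ends x}. \<exists>e'\<in>{x \<in> bd F. p \<in> ends x}. col e \<noteq> col e')"
      unfolding mix_def by blast
    ultimately show ?thesis
      using odd_col_iff[OF at] unfolding at by auto
  next
    case False
    then have "{e \<in> {e \<in> bd F. col e}. p \<in> ends e} = {}" "\<not> mix p F"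
      unfolding mix_def by blast+
    then show ?thesis by (metis card.empty even_zero)
  qed
  then have "{p \<in> V. odd (card {e \<in> {e \<in> bd F. col e}. p \<in> ends e})} = {p. mix p F}"
    using mix_S S by blast
  moreover have "finite (bd F)"
    using finite_subset[OF bd_subset] finite_K finite_E by blast
  moreover have "card (ends e) = 2 \<and> ends e \<subseteq> V" if "e \<in> bd F" for e
    using that bd_subset card_ends ends_subset pts_subset by fast
  ultimately have "even (card {p. mix p F})"
    using even_card_odd_degree[of "{e \<in> bd F. col e}" V ends] finite_V by auto
  then have "{p. mix p F} \<noteq> {s}" by auto
  then show thesis using assms that by blast
qed

text \<open>The main way to produce vertices of \<open>S\<close>: two adjacent edges of different
  colours make the face between them mixed at \<open>s\<close>, and mixed vertices of a face come in
  even number.\<close>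

lemma mixed_corner:
  assumes "C \<in> K" "D \<in> K" "C \<noteq> D" "c \<in> E C" "d \<in> E D" "s \<in> ends c" "s \<in> ends d" "col c \<noteq> col d"
  obtains F t where "c \<in> bd F" "d \<in> bd F" "t \<in> S" "t \<noteq> s" "mix s F" "mix t F"
proof -
  obtain F where F: "c \<in> bd F" "d \<in> bd F"
    using corner assms by blast
  then have "mix s F" using assms unfolding mix_def by blast
  then show thesis
    using mix_other mix_S F that by metis
qed

section \<open>Case analysis on the colour changes at the separator\<close>

lemma mix_edge:
  assumes "mix t F" "C \<in> K" "c \<in> E C" "c \<in> bd F" "t \<in> pts C"
  shows "t \<in> ends c"
  using face_edge assms unfolding mix_def by blast

text \<open>The size bound on \<open>S\<close> enters the case analysis only here.\<close>

lemma S_three: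
  assumes "s \<in> S" "t \<in> S" "r \<in> S" "u \<in> S" "s \<noteq> t" "s \<noteq> r" "t \<noteq> r"
  shows "u = s \<or> u = t \<or> u = r"
proof (rule ccontr)
  assume "\<not> ?thesis"
  then have "card {s, t, r, u} = 4" using assms by auto
  moreover have "card {s, t, r, u} \<le> card S"
    using assms finite_subset[OF S(1) finite_V] by (intro card_mono) auto
  ultimately show False using S by simp
qed

lemma edge_in_S:
  assumes "C \<in> K" "e \<in> E C" "s \<in> ends e" "t \<in> ends e" "s \<noteq> t" "s \<in> S" "t \<in> S"
  shows "ends e \<subseteq> S" "col e"
proof -
  have "finite (ends e)" "card (ends e) = 2"
    using card_ends assms by (auto intro!: card_ge_0_finite)
  then have "ends e = {s, t}"
    using assms card_subset_eq[of "ends e" "{s, t}"] by auto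
  then show "ends e \<subseteq> S" "col e"
    using assms AB unfolding col_def by auto
qed

lemma unicoloured:
  assumes "C \<in> K" "\<And>t. \<not> chg t C" "e \<in> E C" "e' \<in> E C"
  shows "col e = col e'"
proof -
  have "{x \<in> E C. col x = col e} = E C"
    using assms unfolding chg_def by (intro curve_connected[OF assms(1)]) blast+
  then show ?thesis using assms by blast
qed

text \<open>Two curves without colour changes that cross at a point of \<open>S\<close> have different colours, since
  that point sees both colours. They can therefore not cross outside \<open>S\<close>.\<close>

lemma unicoloured_crossing:
  assumes "C \<in> K" "D \<in> K" "C \<noteq> D" and no: "\<And>t. \<not> chg t C" "\<And>t. \<not> chg t D"
    and s: "s \<in> S" "s \<in> pts C" "s \<in> pts D" and x: "x \<in> pts C" "x \<in> pts D"
  shows "x \<in> S"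
proof (rule ccontr)
  assume "x \<notin> S"
  obtain c where c: "c \<in> E C" "x \<in> ends c"
    using edges_at assms by metis
  obtain d where d: "d \<in> E D" "x \<in> ends d"
    using edges_at assms by metis
  have all: "col e = col c" if "X \<in> K" "e \<in> E X" "s \<in> ends e" for X e
  proof -
    have "X = C \<or> X = D"
      using at_most_two_curves[of C D X s] that assms ends_subset by blast
    moreover have "col c = col d"
      using same_col c d assms \<open>x \<notin> S\<close> by blast
    ultimately show ?thesis
      using unicoloured[OF assms(1) no(1)] unicoloured[OF assms(2) no(2)] that c d by blast
  qed
  obtain X a Y b where "X \<in> K" "a \<in> E X" "s \<in> ends a" "ends a \<inter> A \<noteq> {}"
      "Y \<in> K" "b \<in> E Y" "s \<in> ends b" "ends b \<inter> B \<noteq> {}"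
    using minimal_A minimal_B s(1) by meson
  then have "col a" "\<not> col b"
    using separated unfolding col_def by blast+
  then show False
    using all \<open>X \<in> K\<close> \<open>a \<in> E X\<close> \<open>s \<in> ends a\<close> \<open>Y \<in> K\<close> \<open>b \<in> E Y\<close> \<open>s \<in> ends b\<close> by blast
qed

text \<open>If \<open>C\<close> is the only curve that changes colour at \<open>s\<close>, one \<open>C\<close>-edge has a different colour from
  the other three edges, and minimality of \<open>S\<close> forces this edge to leave \<open>S\<close>.\<close>

lemma single_change:
  assumes C: "C \<in> K" "D \<in> K" "C \<noteq> D" and s: "s \<in> pts C" "s \<in> pts D" "chg s C" "\<not> chg s D"
  obtains c where "c \<in> E C" "s \<in> ends c" "\<not> ends c \<subseteq> S"
    "\<forall>d\<in>E D. s \<in> ends d \<longrightarrow> col c \<noteq> col d" "\<forall>F. mix s F \<longrightarrow> c \<in> bd F"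
proof -
  obtain d d' where d: "d \<noteq> d'" "d \<in> E D" "d' \<in> E D" "s \<in> ends d" "s \<in> ends d'" and
    dd: "{e \<in> E D. s \<in> ends e} = {d, d'}"
    using edges_at[OF C(2) s(2)] by metis
  obtain e e' where e: "e \<noteq> e'" "e \<in> E C" "e' \<in> E C" "s \<in> ends e" "s \<in> ends e'" and
    ee: "{x \<in> E C. s \<in> ends x} = {e, e'}"
    using edges_at[OF C(1) s(1)] by metis
  have "col e \<noteq> col e'"
    using s(3) ee unfolding chg_def by (smt (verit) empty_iff insert_iff mem_Collect_eq)
  then obtain c c' where c: "c \<in> E C" "s \<in> ends c" "col c \<noteq> col d" "col c' = col d"
    and cc: "{x \<in> E C. s \<in> ends x} = {c, c'}"
    using e ee by (metis (full_types) insert_commute)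
  have at: "x = c \<or> x = c' \<or> x = d \<or> x = d'" if "X \<in> K" "x \<in> E X" "s \<in> ends x" for X x
  proof -
    have "X = C \<or> X = D"
      using at_most_two_curves[of C D X s] that C s ends_subset by blast
    then show ?thesis using cc dd that by blast
  qed
  have dd': "col d = col d'"
    using s(4) d unfolding chg_def by blast
  have only: "x = c" if "X \<in> K" "x \<in> E X" "s \<in> ends x" "col x \<noteq> col d" for X x
    using at[OF that(1-3)] that(4) dd' c by auto
  have sS: "s \<in> S" using chg_S C s by blast
  have "\<not> ends c \<subseteq> S"
  \<comment> \<open>The colours are not symmetric, since edges inside \<open>S\<close> count as
    edges at \<open>A\<close>. If \<open>c\<close> is not coloured, it meets \<open>B\<close> by
    definition; if it is, the edge from \<open>s\<close> to \<open>A\<close> given by minimality has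
    the same colour and must be \<open>c\<close>.\<close>
  proof (cases "col c")
    case True
    obtain X a where X: "X \<in> K" "a \<in> E X" "s \<in> ends a" "ends a \<inter> A \<noteq> {}"
      using minimal_A[OF sS] by blast
    then have "col a" using separated unfolding col_def by blast
    then have "a = c" using only X True c by metis
    then show ?thesis using X AB by blast
  next
    case False
    then show ?thesis using AB unfolding col_def by blast
  qed
  moreover have "col c \<noteq> col x" if "x \<in> E D" "s \<in> ends x" for x
    using that dd c(3) dd' by fastforce
  moreover have "c \<in> bd F" if F: "mix s F" for F
  proof -
    obtain x y where "x \<in> bd F" "y \<in> bd F" "s \<in> ends x" "s \<in> ends y" "col x \<noteq> col y"
      using F unfolding mix_def by blast
    then show ?thesis
      using only bd_subset by (metis (full_types) UN_E subsetD)
  qed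
  ultimately show thesis using c(1,2) that by blast
qed

text \<open>The deviating edge \<open>c\<close> lies on every face mixed at \<open>s\<close>. If
  \<open>t\<close> were on \<open>C\<close>, it would be an end of \<open>c\<close>, and
  \<open>c\<close> would run inside \<open>S\<close>, against \<open>single_change\<close>.\<close>

lemma single_change_far:
  assumes C: "C \<in> K" "D \<in> K" "C \<noteq> D" and s: "s \<in> pts C" "s \<in> pts D" "chg s C" "\<not> chg s D"
    and "mix s F" "mix t F" "t \<noteq> s"
  shows "t \<notin> pts C"
proof
  assume t: "t \<in> pts C"
  obtain c where c: "c \<in> E C" "s \<in> ends c" "\<not> ends c \<subseteq> S" "c \<in> bd F"
    using single_change[OF C s] \<open>mix s F\<close> by metis
  then have "t \<in> ends c" using mix_edge C t \<open>mix t F\<close> by blast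
  then show False
    using edge_in_S c C mix_S \<open>mix t F\<close> \<open>mix s F\<close> \<open>t \<noteq> s\<close> by blast
qed

text \<open>The two mixed faces beside the deviating edge at \<open>s\<close> lead to the same
  vertex \<open>r\<close> off \<open>C\<close>, and a further change on \<open>C\<close> gives
  \<open>t\<close>; thus \<open>S\<close> consists of \<open>s\<close>, \<open>t\<close> and
  \<open>r\<close>. The two curves through \<open>r\<close> then either never change and cross again
  in \<open>S\<close>, or one of them changes at \<open>t\<close> as well, where
  \<open>single_change_far\<close> at \<open>s\<close> and at \<open>r\<close> leaves no partner for
  a mixed face.\<close>

lemma no_single_change:
  assumes C: "C \<in> K" "D \<in> K" "C \<noteq> D" and s: "s \<in> pts C" "s \<in> pts D" "chg s C"
  shows "chg s D"
proof (rule ccontr)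
  assume sD: "\<not> chg s D"
  note far = single_change_far[OF C s sD]
  have sS: "s \<in> S" using chg_S C s by blast
  obtain t where t: "t \<noteq> s" "chg t C" using chg_other C s by metis
  have tC: "t \<in> pts C" and tS: "t \<in> S" using chg_pts chg_S t C by auto
  obtain c where c: "c \<in> E C" "s \<in> ends c" "\<forall>d\<in>E D. s \<in> ends d \<longrightarrow> col c \<noteq> col d"
    using single_change[OF C s sD] by metis
  obtain d d' where d: "d \<noteq> d'" "d \<in> E D" "d' \<in> E D" "s \<in> ends d" "s \<in> ends d'"
    using edges_at[OF C(2) s(2)] by metis
  obtain F r where F: "c \<in> bd F" "d \<in> bd F" "mix s F" and r: "r \<in> S" "r \<noteq> s" "mix r F"
    using mixed_corner[OF C c(1) d(2) c(2) d(4)] c(3) d by metis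
  obtain F' r' where F': "c \<in> bd F'" "d' \<in> bd F'" "mix s F'" and r': "r' \<in> S" "r' \<noteq> s" "mix r' F'"
    using mixed_corner[OF C c(1) d(3) c(2) d(5)] c(3) d by metis
  have rC: "r \<notin> pts C" "r' \<notin> pts C"
    using far F F' r r' by blast+
  then have "r' = r"
    using S_three[OF sS tS r(1) r'(1)] t r r' tC by metis
  \<comment> \<open>Otherwise \<open>d\<close> and \<open>d'\<close> are parallel, \<open>D\<close>
    has only the vertices \<open>s\<close> and \<open>r\<close>, and its second crossing with
    \<open>C\<close> would have to be \<open>r\<close>.\<close>
  have rD: "r \<notin> pts D"
  proof
    assume "r \<in> pts D"
    then have "r \<in> ends d" "r \<in> ends d'"
      using mix_edge C d F F' r r' \<open>r' = r\<close> by blast+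
    then have "pts D = {s, r}"
      using parallel_edges[OF C(2) d(2,3,1)] d r by auto
    moreover obtain q where "q \<noteq> s" "q \<in> pts C" "q \<in> pts D"
      using meets_again[OF C s(1,2)] by blast
    ultimately show False using rC by auto
  qed
  have S3: "u = s \<or> u = t \<or> u = r" if "u \<in> S" for u
    using S_three[OF sS tS r(1) that] t r rC tC by metis
  obtain X Y where XY: "X \<in> K" "Y \<in> K" "X \<noteq> Y" "r \<in> pts X" "r \<in> pts Y"
    using curves_at r S by (metis subsetD)
  have XYs: "s \<notin> pts X" "s \<notin> pts Y"
    using at_most_two_curves[OF C(1,2) _ s(1,2) _ C(3)] XY rC rD by blast+
  have XC: "X \<noteq> C" "Y \<noteq> C" using XY rC by auto
  have tXY: "t \<notin> pts X \<or> t \<notin> pts Y"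
    using at_most_two_curves[of X Y C t] XY C tC XC by blast
  have chgXY: "chg t Z \<and> chg r Z" if u: "chg u Z" "Z = X \<or> Z = Y" for u Z
  proof -
    have Z: "Z \<in> K" "\<not> chg s Z" using that XY XYs chg_pts by auto
    obtain v where "v \<noteq> u" "chg v Z" using chg_other Z u by metis
    then show ?thesis using S3 chg_S Z u by metis
  qed
  show False
  proof (cases "(\<exists>u. chg u X) \<or> (\<exists>u. chg u Y)")
    case False
    obtain q where q: "q \<noteq> r" "q \<in> pts X" "q \<in> pts Y"
      using meets_again XY by metis
    then have "q \<in> S"
      using unicoloured_crossing[of X Y r q] False XY r by blast
    then show False using S3 q XYs tXY by blast
  next
    case True
    then obtain X' Y' where X': "X' \<in> K" "Y' \<in> K" "X' \<noteq> Y'" "r \<in> pts X'" "r \<in> pts Y'" "chg t X'" "chg r X'"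
      "X' \<noteq> C" "t \<notin> pts Y' \<or> t \<notin> pts X'" "\<And>u. chg u Y' \<Longrightarrow> chg t Y'"
      using chgXY XY tXY XC by (metis (no_types))
    have tX': "t \<in> pts X'" using chg_pts X' by blast
    \<comment> \<open>A change of \<open>Y'\<close> at \<open>r\<close> would force one at
      \<open>t\<close>, which is not on \<open>Y'\<close>. So exactly one curve changes at
      \<open>r\<close> too, and \<open>single_change_far\<close> applies there.\<close>
    then have "\<not> chg r Y'" using X' chg_pts by blast
    note far' = single_change_far[OF X'(1-5,7) this]
    obtain e e' where e: "e \<in> E C" "e' \<in> E C" "t \<in> ends e" "t \<in> ends e'" "col e \<noteq> col e'"
      using t unfolding chg_def by blast
    obtain x where x: "x \<in> E X'" "t \<in> ends x" using edges_at X' tX' by metis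
    obtain z where z: "z \<in> E C" "t \<in> ends z" "col z \<noteq> col x"
      using e by metis
    \<comment> \<open>If \<open>u\<close> is \<open>s\<close>, the face \<open>H\<close> forbids
      \<open>t\<close> on \<open>C\<close>; if \<open>u\<close> is \<open>r\<close>, it forbids
      \<open>t\<close> on \<open>X'\<close>. But \<open>t\<close> is a crossing of \<open>C\<close>
      and \<open>X'\<close>.\<close>
    obtain H u where H: "mix t H" "mix u H" "u \<in> S" "u \<noteq> t"
      using mixed_corner[OF C(1) X'(1) X'(8)[symmetric] z(1) x(1) z(2) x(2) z(3)] by metis
    then consider "u = s" | "u = r" using S3 by blast
    then show False
      using far[of H t] far'[of H t] H tC tX' by cases auto
  qed
qed

text \<open>Now both curves change at \<open>s\<close>, and two opposite corners there are mixed,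
  with partners \<open>u\<close> off \<open>D\<close> and \<open>w\<close> off \<open>C\<close>. If
  \<open>C\<close> and \<open>D\<close> share another vertex of \<open>S\<close>, then
  \<open>u\<close> and \<open>w\<close> coincide, and the curves through \<open>u\<close> cannot
  change, yet must cross again in \<open>S\<close>. Otherwise both \<open>A\<close>-coloured edges
  at \<open>s\<close> end in \<open>S\<close>, so \<open>s\<close> has no edge to
  \<open>A\<close>.\<close>

lemma no_change:
  assumes "C \<in> K"
  shows "\<not> chg s C"
proof
  assume sC: "chg s C"
  have s: "s \<in> S" "s \<in> pts C" using chg_S chg_pts assms sC by auto
  obtain D where D: "D \<in> K" "C \<noteq> D" and sD': "s \<in> pts D" and
    only: "\<forall>X\<in>K. s \<in> pts X \<longrightarrow> X = C \<or> X = D"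
    using other_curve[OF assms s(2)] by metis
  note C = assms D
  have sD: "chg s D" using no_single_change C s sD' sC by blast
  obtain c c' where c: "c \<in> E C" "c' \<in> E C" "s \<in> ends c" "s \<in> ends c'" "col c" "\<not> col c'"
    using sC unfolding chg_def by blast
  obtain d d' where d: "d \<in> E D" "d' \<in> E D" "s \<in> ends d" "s \<in> ends d'" "col d" "\<not> col d'"
    using sD unfolding chg_def by blast
  have cc: "{x \<in> E C. s \<in> ends x} = {c, c'}"
    using edges_at[OF C(1) s(2)] c by (smt (verit) empty_iff insertE insert_iff mem_Collect_eq subset_antisym subsetI)
  have dd: "{x \<in> E D. s \<in> ends x} = {d, d'}"
    using edges_at[OF C(2) sD'] d by (smt (verit) empty_iff insertE insert_iff mem_Collect_eq subset_antisym subsetI)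
  obtain F u where F: "c \<in> bd F" "d' \<in> bd F" and u: "u \<in> S" "u \<noteq> s" "mix u F"
    using mixed_corner[OF C c(1) d(2) c(3) d(4)] c d by metis
  obtain F' w where F': "c' \<in> bd F'" "d \<in> bd F'" and w: "w \<in> S" "w \<noteq> s" "mix w F'"
    using mixed_corner[OF C c(2) d(1) c(4) d(3)] c d by metis
  \<comment> \<open>On \<open>D\<close> it would be an end of \<open>d'\<close>; then
    \<open>d'\<close> would run inside \<open>S\<close> and be coloured, which it is not.\<close>
  have uD: "u \<notin> pts D"
    using mix_edge[OF u(3) C(2) d(2) F(2)] edge_in_S[OF C(2) d(2,4)] u s d by blast
  have wC: "w \<notin> pts C"
    using mix_edge[OF w(3) C(1) c(2) F'(1)] edge_in_S[OF C(1) c(2,4)] w s c by blast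
  obtain t where t: "t \<noteq> s" "chg t C" using chg_other C sC by metis
  obtain t' where t': "t' \<noteq> s" "chg t' D" using chg_other C sD by metis
  have tp: "t \<in> S" "t \<in> pts C" "t' \<in> S" "t' \<in> pts D"
    using chg_S chg_pts t t' C by auto
  show False
  proof (cases "\<exists>p\<in>S. p \<noteq> s \<and> p \<in> pts C \<and> p \<in> pts D")
    case True
    then obtain p where p: "p \<in> S" "p \<noteq> s" "p \<in> pts C" "p \<in> pts D" by blast
    have wu: "w = u"
      using S_three[OF s(1) p(1) u(1) w(1)] p u w uD wC by metis
    have S3: "q = s \<or> q = p \<or> q = u" if "q \<in> S" for q
      using S_three[OF s(1) p(1) u(1) that] p u uD by metis
    obtain X Y where XY: "X \<in> K" "Y \<in> K" "X \<noteq> Y" "u \<in> pts X" "u \<in> pts Y"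
      using curves_at u S by (metis subsetD)
    have notin: "s \<notin> pts Z \<and> p \<notin> pts Z" if "Z = X \<or> Z = Y" for Z
      using at_most_two_curves[of C D Z] C s sD' p XY uD wC wu that by metis
    have "\<not> chg q Z" if "Z = X \<or> Z = Y" for q Z
    proof
      assume q: "chg q Z"
      have "Z \<in> K" using that XY by auto
      then obtain q' where "q' \<noteq> q" "chg q' Z" using chg_other q by metis
      then show False
        using S3 q chg_S chg_pts notin[OF that] \<open>Z \<in> K\<close> by metis
    qed
    moreover obtain q where "q \<noteq> u" "q \<in> pts X" "q \<in> pts Y"
      using meets_again XY by metis
    ultimately show False
      using unicoloured_crossing[of X Y u q] XY u S3 notin by blast
  next
    case False
    then have "t' \<notin> pts C" "t \<notin> pts D" "t \<noteq> t'" using t t' tp by blast+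
    have S3: "q = s \<or> q = t \<or> q = t'" if "q \<in> S" for q
      using S_three[OF s(1) tp(1,3) that] t t' \<open>t \<noteq> t'\<close> by metis
    have "u = t" "w = t'" using S3 u w uD wC tp by metis+
    then have "ends c \<subseteq> S" "ends d \<subseteq> S"
      using mix_edge[OF u(3) C(1) c(1) F(1)] edge_in_S[OF C(1) c(1,3)]
        mix_edge[OF w(3) C(2) d(1) F'(2)] edge_in_S[OF C(2) d(1,3)] u w s tp by blast+
    obtain X a where X: "X \<in> K" "a \<in> E X" "s \<in> ends a" "ends a \<inter> A \<noteq> {}"
      using minimal_A[OF s(1)] by blast
    then have "X = C \<or> X = D" using only ends_subset by blast
    then have "a = c \<or> a = c' \<or> a = d \<or> a = d'" using X cc dd by blast
    moreover have "col a" using X separated unfolding col_def by blast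
    ultimately show False
      using X AB \<open>ends c \<subseteq> S\<close> \<open>ends d \<subseteq> S\<close> c d by blast
  qed
qed

text \<open>Minimality may shrink \<open>S\<close> to the empty set. Then unicoloured curves that
  cross agree in colour, so the curves with the colour of \<open>A\<close> form a nonempty proper
  subsystem that meets no other curve.\<close>

lemma S_nonempty: "S \<noteq> {}"
proof
  assume "S = {}"
  define X where "X = {C \<in> K. \<exists>e\<in>E C. col e}"
  obtain a b where ab: "a \<in> A" "b \<in> B" using nonempty by blast
  have colour_at: "\<exists>C\<in>K. \<exists>e\<in>E C. p \<in> ends e" if "p \<in> V" for p
    using curves_at[OF that] edges_at by metis
  have "X \<noteq> {}"
    using colour_at[of a] ab separated AB unfolding X_def col_def by blast
  moreover obtain C e where C: "C \<in> K" "e \<in> E C" "b \<in> ends e"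
    using colour_at[of b] ab AB by blast
  then have "C \<notin> X"
    using unicoloured[OF C(1) no_change[OF C(1)] C(2)] ab unfolding X_def col_def by blast
  ultimately obtain Y Z p where YZ: "Y \<in> X" "Z \<in> K - X" "p \<in> pts Y" "p \<in> pts Z"
    using system_connected[of X] C unfolding X_def by blast
  then have YK: "Y \<in> K" unfolding X_def by auto
  obtain e where e: "e \<in> E Y" "p \<in> ends e" using edges_at YK YZ by metis
  obtain f where f: "f \<in> E Z" "p \<in> ends f" using edges_at YZ by (metis DiffD1)
  have "col e" using YZ e unicoloured[OF YK no_change[OF YK]] unfolding X_def by blast
  moreover have "\<not> col f" using YZ f unfolding X_def by blast
  ultimately show False using same_col YK YZ e f \<open>S = {}\<close> by blast
qed

text \<open>Without changes the two curves at \<open>s\<close> have different colours, so all four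
  corners at \<open>s\<close> are mixed. The second crossing \<open>t\<close> cannot serve as
  partner, so all four faces share the third vertex \<open>r\<close>. It lies on neither
  \<open>C\<close> nor \<open>D\<close>, and the two curves through \<open>r\<close> would cross
  again at \<open>s\<close> or \<open>t\<close>, where \<open>C\<close> and \<open>D\<close> already
  pass.\<close>

lemma contradiction: False
proof -
  obtain s where s: "s \<in> S" using S_nonempty by blast
  then have "s \<in> V" using S by blast
  then obtain C D where C: "C \<in> K" "D \<in> K" "C \<noteq> D" and sp: "s \<in> pts C" "s \<in> pts D" and
    only: "\<forall>X\<in>K. s \<in> pts X \<longrightarrow> X = C \<or> X = D"
    by (rule curves_at)
  have cross: "x \<in> S" if "X \<in> K" "Y \<in> K" "X \<noteq> Y" "r \<in> S" "r \<in> pts X" "r \<in> pts Y" "x \<in> pts X" "x \<in> pts Y"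
    for X Y r x
    using unicoloured_crossing[of X Y r x] no_change that by blast
  obtain t where t: "t \<noteq> s" "t \<in> pts C" "t \<in> pts D"
    using meets_again C sp by metis
  then have tS: "t \<in> S" using cross C s sp by blast
  obtain c c' where c: "c \<noteq> c'" "c \<in> E C" "c' \<in> E C" "s \<in> ends c" "s \<in> ends c'"
    using edges_at[OF C(1) sp(1)] by metis
  obtain d d' where d: "d \<noteq> d'" "d \<in> E D" "d' \<in> E D" "s \<in> ends d" "s \<in> ends d'"
    using edges_at[OF C(2) sp(2)] by metis
  have uC: "col e = col e'" if "e \<in> E C" "e' \<in> E C" for e e'
    using unicoloured[OF C(1) no_change[OF C(1)] that] .
  have uD: "col e = col e'" if "e \<in> E D" "e' \<in> E D" for e e'
    using unicoloured[OF C(2) no_change[OF C(2)] that] .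
  have differ: "col e \<noteq> col f" if "e \<in> E C" "f \<in> E D" for e f
  proof -
    obtain X a Y b where a: "X \<in> K" "a \<in> E X" "s \<in> ends a" "ends a \<inter> A \<noteq> {}" and
      b: "Y \<in> K" "b \<in> E Y" "s \<in> ends b" "ends b \<inter> B \<noteq> {}"
      using minimal_A minimal_B s by meson
    then have "col a" "\<not> col b"
      using separated unfolding col_def by blast+
    moreover have "X = C \<or> X = D" "Y = C \<or> Y = D"
      using only ends_subset a b by blast+
    ultimately show ?thesis using uC uD a b that by metis
  qed
  have faces: "\<exists>u F. e \<in> bd F \<and> f \<in> bd F \<and> u \<in> S \<and> u \<noteq> s \<and> u \<noteq> t \<and> mix u F"
    if "e \<in> {c, c'}" "f \<in> {d, d'}" for e f
  proof -
    have ef: "e \<in> E C" "f \<in> E D" "s \<in> ends e" "s \<in> ends f" using that c d by auto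
    obtain F u where F: "e \<in> bd F" "f \<in> bd F" and u: "u \<in> S" "u \<noteq> s" "mix u F"
      using mixed_corner[OF C ef differ[OF ef(1,2)]] by metis
    \<comment> \<open>Both \<open>e\<close> and \<open>f\<close> would join \<open>s\<close> to
      \<open>t\<close> inside \<open>S\<close> and hence have the same colour.\<close>
    have "u \<noteq> t"
    proof
      assume "u = t"
      then have "u \<in> ends e" "u \<in> ends f"
        using mix_edge C F ef u t by blast+
      then show False
        using edge_in_S(2)[of C e s u] edge_in_S(2)[of D f s u] C ef u s differ by blast
    qed
    then show ?thesis using F u by blast
  qed
  obtain r where r: "r \<in> S" "r \<noteq> s" "r \<noteq> t"
    using faces[of c d] by blast
  have S3: "q = s \<or> q = t \<or> q = r" if "q \<in> S" for q
    using S_three[OF s tS r(1) that] t r by metis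
  have ends: "e \<in> bd F \<and> f \<in> bd F \<and> mix r F \<Longrightarrow> (r \<in> pts C \<longrightarrow> r \<in> ends e) \<and> (r \<in> pts D \<longrightarrow> r \<in> ends f)"
    if "e \<in> {c, c'}" "f \<in> {d, d'}" for e f F
    using mix_edge C that c d by blast
  have all: "(r \<in> pts C \<longrightarrow> r \<in> ends e) \<and> (r \<in> pts D \<longrightarrow> r \<in> ends f)"
    if "e \<in> {c, c'}" "f \<in> {d, d'}" for e f
    using faces[OF that] ends[OF that] S3 by metis
  have "r \<notin> pts C"
  proof
    assume "r \<in> pts C"
    then have "r \<in> ends c" "r \<in> ends c'" using all[of c d] all[of c' d] by auto
    then have "pts C = {s, r}" using parallel_edges[OF C(1) c(2,3,1)] c r by auto
    then show False using t r by auto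
  qed
  moreover have "r \<notin> pts D"
  proof
    assume "r \<in> pts D"
    then have "r \<in> ends d" "r \<in> ends d'" using all[of c d] all[of c d'] by auto
    then have "pts D = {s, r}" using parallel_edges[OF C(2) d(2,3,1)] d r by auto
    then show False using t r by auto
  qed
  moreover obtain X Y where XY: "X \<in> K" "Y \<in> K" "X \<noteq> Y" "r \<in> pts X" "r \<in> pts Y"
    using curves_at r S by (metis subsetD)
  moreover obtain q where q: "q \<noteq> r" "q \<in> pts X" "q \<in> pts Y"
    using meets_again XY by metis
  moreover have "q \<in> S" using cross XY q r by blast
  ultimately show False
    using at_most_two_curves[of C D X q] C sp t S3 by blast
qed

end

section \<open>Reduction to minimal separations\<close>

context curve_arrangement
begin

text \<open>A vertex of \<open>S\<close> without an edge to \<open>A\<close> can be moved to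
  \<open>B\<close>, and conversely, which leaves a smaller separating set. So the induction may
  assume the minimality conditions.\<close>

theorem no_small_separation:
  assumes "S \<subseteq> V" "card S \<le> 3" "V - S = A \<union> B" "A \<inter> B = {}" "A \<noteq> {}" "B \<noteq> {}"
    and sep: "\<And>C e. C \<in> K \<Longrightarrow> e \<in> E C \<Longrightarrow> ends e \<inter> A \<noteq> {} \<Longrightarrow> ends e \<inter> B = {}"
  shows False
  using assms
proof (induction "card S" arbitrary: S A B rule: less_induct)
  case less
  have smaller: "card (S - {s}) < card S" if "s \<in> S" for s
    using that finite_subset[OF less.prems(1) finite_V] by (intro psubset_card_mono) auto
  have A: "\<exists>C\<in>K. \<exists>e\<in>E C. s \<in> ends e \<and> ends e \<inter> A \<noteq> {}" if s: "s \<in> S" for s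
  proof (rule ccontr)
    assume "\<not> ?thesis"
    then have none: "C \<in> K \<Longrightarrow> e \<in> E C \<Longrightarrow> s \<in> ends e \<Longrightarrow> ends e \<inter> A = {}" for C e
      by blast
    show False
    proof (rule less.hyps[of "S - {s}" A "insert s B"])
      show "ends e \<inter> insert s B = {}" if "C \<in> K" "e \<in> E C" "ends e \<inter> A \<noteq> {}" for C e
        using that none less.prems(7) by blast
    qed (use less.prems s smaller[OF s] in auto)
  qed
  have B: "\<exists>C\<in>K. \<exists>e\<in>E C. s \<in> ends e \<and> ends e \<inter> B \<noteq> {}" if s: "s \<in> S" for s
  proof (rule ccontr)
    assume "\<not> ?thesis"
    then have none: "C \<in> K \<Longrightarrow> e \<in> E C \<Longrightarrow> s \<in> ends e \<Longrightarrow> ends e \<inter> B = {}" for C e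
      by blast
    show False
    proof (rule less.hyps[of "S - {s}" "insert s A" B])
      show "ends e \<inter> B = {}" if "C \<in> K" "e \<in> E C" "ends e \<inter> insert s A \<noteq> {}" for C e
        using that none less.prems(7) by blast
    qed (use less.prems s smaller[OF s] in auto)
  qed
  interpret minimal_separation V K pts E ends bd S A B
    using less.prems A B by unfold_locales auto
  show False by (rule contradiction)
qed

end

section \<open>Local structure at a crossing\<close>

lemma simple_closed_curveD:
  assumes "simple_closed_curve C"
  shows "compact C" "Topological_Spaces.connected C" "C \<noteq> {}" "inside C \<inter> outside C = {}"
    "inside C \<union> outside C = - C" "open (inside C)" "open (outside C)"
    "frontier (inside C) = C" "frontier (outside C) = C"
proof -
  obtain g where g: "simple_path g" "pathfinish g = pathstart g" and C: "C = path_image g"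
    using assms unfolding simple_closed_curve_def by metis
  show "compact C" "Topological_Spaces.connected C" "C \<noteq> {}"
    using C g by (auto simp: compact_simple_path_image connected_simple_path_image)
  show "inside C \<inter> outside C = {}" "inside C \<union> outside C = - C" "open (inside C)" "open (outside C)"
    "frontier (inside C) = C" "frontier (outside C) = C"
    using Jordan_inside_outside[OF g] C by auto
qed

text \<open>A boolean index lets pairs of booleans name the four quadrants at a crossing.\<close>

definition side :: "complex set \<Rightarrow> bool \<Rightarrow> complex set" where
  "side D b = (if b then inside D else outside D)"

lemma side:
  assumes "simple_closed_curve D"
  shows "open (side D b)" "side D b \<inter> D = {}" "side D True \<inter> side D False = {}"
    "x \<notin> D \<Longrightarrow> \<exists>b. x \<in> side D b" "x \<in> side D b \<Longrightarrow> x \<in> side D b' \<Longrightarrow> b = b'" "frontier (side D b) = D"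
proof -
  note J = simple_closed_curveD[OF assms]
  show "open (side D b)" "frontier (side D b) = D"
    using J(6-9) by (simp_all add: side_def)
  show "side D b \<inter> D = {}"
    using J(5) unfolding side_def by (cases b; simp only: if_True if_False; blast)
  show "side D True \<inter> side D False = {}"
    using J(4) by (simp add: side_def)
  show "\<exists>b. x \<in> side D b" if "x \<notin> D"
  proof -
    have "x \<in> inside D \<or> x \<in> outside D" using J(5) that by blast
    then show ?thesis unfolding side_def by (metis (full_types))
  qed
  show "b = b'" if "x \<in> side D b" "x \<in> side D b'"
    using J(4) that unfolding side_def by (cases b; cases b'; simp only: if_True if_False; blast)
qed

lemma connected_side:
  assumes "simple_closed_curve D" "Topological_Spaces.connected T" "T \<inter> D = {}"
  obtains b where "T \<subseteq> side D b"
proof -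
  have "\<exists>b. T \<subseteq> side D b"
  proof (cases "T \<inter> inside D = {}")
    case True
    moreover have "T \<subseteq> inside D \<union> outside D"
      using simple_closed_curveD(5)[OF assms(1)] assms(3) by blast
    ultimately have "T \<subseteq> side D False"
      unfolding side_def by (simp only: if_False) blast
    then show ?thesis ..
  next
    case False
    then have "T - inside D = {}"
      using connected_Int_frontier[OF assms(2) False] simple_closed_curveD(8)[OF assms(1)] assms(3) by auto
    then show ?thesis by (intro exI[of _ True]) (auto simp: side_def)
  qed
  then show thesis using that by blast
qed

text \<open>The coordinates of \<open>cross_at\<close>, but with a ball of any radius, so that a
  chart can be shrunk away from a closed set.\<close>

definition chart :: "complex set \<Rightarrow> complex set \<Rightarrow> complex \<Rightarrow> complex set \<Rightarrow> (complex \<Rightarrow> complex) \<Rightarrow> bool" where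
  "chart C D p U f \<longleftrightarrow> open U \<and> p \<in> U \<and> f p = 0 \<and>
     (\<exists>r>0. \<exists>g. homeomorphism U (ball 0 r) f g) \<and>
     (\<forall>x\<in>U. (x \<in> C \<longleftrightarrow> Im (f x) = 0) \<and> (x \<in> D \<longleftrightarrow> Re (f x) = 0))"

text \<open>Reflection in the diagonal exchanges real and imaginary parts and preserves balls around
  0; facts about \<open>C\<close> thereby transfer to \<open>D\<close>.\<close>

lemma chart_swap:
  assumes "chart C D p U f"
  shows "chart D C p U (\<lambda>x. \<i> * cnj (f x))"
proof -
  obtain r g where r: "r > 0" "homeomorphism U (ball 0 r) f g"
    using assms unfolding chart_def by blast
  have inv: "\<i> * cnj (\<i> * cnj z) = z" for z
    by (simp add: complex_eq_iff)
  have norm: "norm (\<i> * cnj z) = norm z" for z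
    by (simp add: norm_mult)
  have "homeomorphism (ball 0 r) (ball 0 r) (\<lambda>z. \<i> * cnj z) (\<lambda>z. \<i> * cnj z)"
    by (rule homeomorphismI) (auto intro!: continuous_intros simp: norm inv)
  then have "homeomorphism U (ball 0 r) ((\<lambda>z. \<i> * cnj z) \<circ> f) (g \<circ> (\<lambda>z. \<i> * cnj z))"
    using homeomorphism_compose r by blast
  then show ?thesis
    using assms r unfolding chart_def by (auto simp: o_def)
qed

lemma connected_chart:
  assumes "chart C D p U f" "convex T"
  shows "Topological_Spaces.connected {x \<in> U. f x \<in> T}"
proof -
  obtain r g where r: "r > 0" "homeomorphism U (ball 0 r) f g"
    using assms unfolding chart_def by blast
  have "{x \<in> U. f x \<in> T} = g ` (ball 0 r \<inter> T)"
  proof (intro equalityI subsetI)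
    fix x assume "x \<in> {x \<in> U. f x \<in> T}"
    then have "x = g (f x)" "f x \<in> ball 0 r \<inter> T"
      using r by (auto simp: homeomorphism_def)
    then show "x \<in> g ` (ball 0 r \<inter> T)" by blast
  next
    fix x assume "x \<in> g ` (ball 0 r \<inter> T)"
    then show "x \<in> {x \<in> U. f x \<in> T}"
      using r by (auto simp: homeomorphism_def)
  qed
  moreover have "continuous_on (ball 0 r \<inter> T) g"
    using r continuous_on_subset[of "ball 0 r" g "ball 0 r \<inter> T"] unfolding homeomorphism_def by auto
  moreover have "Topological_Spaces.connected (ball 0 r \<inter> T)"
    by (intro convex_connected convex_Int assms(2) convex_ball)
  ultimately show ?thesis using connected_continuous_image[of "ball 0 r \<inter> T" g] by simp
qed

lemma closure_chart:
  assumes "chart C D p U f" "x \<in> U" "f x \<in> closure T"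
  shows "x \<in> closure {x \<in> U. f x \<in> T}"
proof -
  obtain r g where r: "r > 0" "homeomorphism U (ball 0 r) f g"
    using assms unfolding chart_def by blast
  have "V \<inter> {x \<in> U. f x \<in> T} \<noteq> {}" if V: "open V" "x \<in> V" for V
  proof -
    have "openin (top_of_set U) (V \<inter> U)"
      using V by (simp add: openin_open_Int Int_commute)
    then have "openin (top_of_set (ball 0 r)) (f ` (V \<inter> U))"
      using homeomorphism_imp_open_map[OF r(2)] by blast
    then have "open (f ` (V \<inter> U))"
      using openin_open_trans open_ball by blast
    moreover have "f x \<in> f ` (V \<inter> U)" using V assms by blast
    ultimately have "T \<inter> f ` (V \<inter> U) \<noteq> {}"
      using assms(3) by (meson IntI closure_iff_nhds_not_empty order_refl empty_iff)
    then show ?thesis by blast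
  qed
  then show ?thesis
    unfolding closure_iff_nhds_not_empty by blast
qed

lemma closure_quadrant:
  assumes "s \<noteq> 0" "t \<noteq> 0" "0 \<le> s * Re z" "0 \<le> t * Im z"
  shows "z \<in> closure {z. 0 < s * Re z \<and> 0 < t * Im z}"
  unfolding closure_approachable
proof (intro allI impI)
  fix e :: real assume "e > 0"
  \<comment> \<open>A step in direction \<open>w\<close> increases both \<open>s * Re z\<close> and
    \<open>t * Im z\<close>; the factor \<open>d\<close> gives it length
    \<open>e / 2\<close>.\<close>
  define w where "w = Complex s t"
  define d where "d = e / (2 * norm w)"
  have w: "norm w > 0" using assms by (auto simp: w_def complex_eq_iff)
  then have d: "d > 0" using \<open>e > 0\<close> by (simp add: d_def)
  have "0 < d * (s * s)" "0 < d * (t * t)"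
    using d assms by (auto simp: zero_less_mult_iff)
  then have "0 < s * Re (z + d * w)" "0 < t * Im (z + d * w)"
    using assms by (auto simp: w_def algebra_simps)
  moreover have "dist (z + d * w) z < e"
    using w d \<open>e > 0\<close> by (simp add: dist_norm norm_mult norm_divide d_def)
  ultimately show "\<exists>y\<in>{z. 0 < s * Re z \<and> 0 < t * Im z}. dist y z < e" by blast
qed

lemma closure_axis:
  assumes "s \<noteq> 0"
  shows "0 \<in> closure {z. 0 < s * Re z \<and> Im z = 0}"
  unfolding closure_approachable
proof (intro allI impI)
  fix e :: real assume "e > 0"
  define d where "d = e / (2 * \<bar>s\<bar>)"
  have d: "d > 0" using \<open>e > 0\<close> assms by (simp add: d_def)
  have "0 < d * (s * s)"
    using d assms by (auto simp: zero_less_mult_iff)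
  moreover have "dist (complex_of_real (d * s)) 0 < e"
    using assms d \<open>e > 0\<close> by (simp add: norm_mult norm_divide d_def)
  ultimately show "\<exists>y\<in>{z. 0 < s * Re z \<and> Im z = 0}. dist y 0 < e"
    by (intro bexI[of _ "complex_of_real (d * s)"]) (auto simp: algebra_simps)
qed

lemma convex_sector:
  "convex {z. 0 < s * Re z}" "convex {z. 0 < s * Re z \<and> 0 < t * Im z}" "convex {z. 0 < s * Re z \<and> Im z = 0}"
    "convex {z. Im z = 0}"
proof -
  have A: "{z. 0 < s * Re z} = {z. inner (complex_of_real s) z > 0}" for s
    by (auto simp: inner_complex_def)
  have B: "{z. 0 < t * Im z} = {z. inner (t * \<i>) z > 0}" for t
    by (auto simp: inner_complex_def)
  have C: "{z. Im z = 0} = {z. inner \<i> z = 0}"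
    by (auto simp: inner_complex_def)
  show *: "convex {z. 0 < s * Re z}" "convex {z. Im z = 0}"
    unfolding A by (simp add: convex_halfspace_gt) (simp only: C convex_hyperplane)
  have "convex {z. 0 < t * Im z}" unfolding B by (simp add: convex_halfspace_gt)
  then show "convex {z. 0 < s * Re z \<and> 0 < t * Im z}" "convex {z. 0 < s * Re z \<and> Im z = 0}"
    unfolding Collect_conj_eq using * by (simp_all add: convex_Int)
qed

text \<open>Each open half of the chart misses \<open>D\<close>, so it lies on one side. By the
  Jordan curve theorem \<open>p\<close> is in the frontier of both sides, so both occur near
  \<open>p\<close> and the halves lie on different ones. This ties local signs to the global
  sides.\<close>

lemma chart_side:
  assumes ch: "chart C D p U f" and D: "simple_closed_curve D"
  obtains s where "\<And>b. s b \<noteq> 0" "\<And>b x. x \<in> U \<Longrightarrow> x \<in> side D b \<longleftrightarrow> 0 < s b * Re (f x)"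
proof -
  define H where "H s = {x \<in> U. 0 < s * Re (f x)}" for s
  have axis: "x \<in> D \<longleftrightarrow> Re (f x) = 0" if "x \<in> U" for x
    using ch that unfolding chart_def by auto
  have U: "open U" "p \<in> U" "p \<in> D"
    using ch unfolding chart_def by auto
  have half: "\<exists>b. H s \<subseteq> side D b" for s
  proof -
    have "Topological_Spaces.connected (H s)"
      using connected_chart[OF ch convex_sector(1)[of s]] by (simp add: H_def)
    moreover have "H s \<inter> D = {}" using axis by (auto simp: H_def)
    ultimately show ?thesis using connected_side[OF D] by metis
  qed
  obtain b where b: "H 1 \<subseteq> side D b" using half by blast
  obtain b' where b': "H (-1) \<subseteq> side D b'" using half by blast
  have cov: "x \<in> D \<or> x \<in> H 1 \<or> x \<in> H (-1)" if "x \<in> U" for x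
    using axis[OF that] that by (auto simp: H_def)
  have "\<exists>x\<in>U. x \<in> side D c" for c
  proof -
    have "p \<in> closure (side D c)"
      using side(6)[OF D, of c] U(3) unfolding frontier_def by blast
    then show ?thesis
      using U(1,2) by (meson closure_iff_nhds_not_empty disjoint_iff order_refl)
  qed
  then obtain x where "x \<in> U" "x \<in> side D (\<not> b)" by blast
  then have "b' = (\<not> b)"
    using cov[of x] b b' side(2,5)[OF D] by blast
  define s where "s c = (if c = b then 1 else - 1 :: real)" for c
  have "x \<in> side D c \<longleftrightarrow> 0 < s c * Re (f x)" if x: "x \<in> U" for c x
  proof
    assume c: "x \<in> side D c"
    then consider "x \<in> H 1" | "x \<in> H (-1)"
      using cov[OF x] side(2)[OF D, of c] by blast
    then show "0 < s c * Re (f x)"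
    proof cases
      case 1
      then have "c = b" using side(5)[OF D] b c by blast
      then show ?thesis using 1 by (simp add: s_def H_def)
    next
      case 2
      then have "c \<noteq> b" using side(5)[OF D] b' \<open>b' = (\<not> b)\<close> c by blast
      then show ?thesis using 2 by (simp add: s_def H_def)
    qed
  next
    assume c: "0 < s c * Re (f x)"
    show "x \<in> side D c"
    proof (cases "c = b")
      case True
      then show ?thesis using b c x by (auto simp: s_def H_def)
    next
      case False
      then show ?thesis using b' \<open>b' = (\<not> b)\<close> c x by (auto simp: s_def H_def)
    qed
  qed
  moreover have "s c \<noteq> 0" for c by (simp add: s_def)
  ultimately show thesis using that by blast
qed

text \<open>The part of a neighbourhood of a crossing \<open>p\<close> of \<open>C\<close> and \<open>D\<close> that concerns \<open>C\<close>: the two branches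
  of \<open>C\<close> are separated by \<open>D\<close>, and each is adjacent to the two quadrants on its side of \<open>D\<close>.\<close>

definition branches :: "complex set \<Rightarrow> complex set \<Rightarrow> complex \<Rightarrow> complex set \<Rightarrow> bool" where
  "branches C D p U \<longleftrightarrow> open U \<and> p \<in> U \<and> C \<inter> D \<inter> U = {p} \<and> Topological_Spaces.connected (C \<inter> U) \<and>
     (\<forall>b. Topological_Spaces.connected (C \<inter> U \<inter> side D b) \<and> p \<in> closure (C \<inter> U \<inter> side D b)) \<and>
     (\<forall>b b'. Topological_Spaces.connected (U \<inter> side C b \<inter> side D b') \<and>
        C \<inter> U \<inter> side D b' \<subseteq> closure (U \<inter> side C b \<inter> side D b'))"

lemma branches_chart:
  assumes ch: "chart C D p U f" and C: "simple_closed_curve C" and D: "simple_closed_curve D"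
  shows "branches C D p U"
proof -
  have U: "open U" "p \<in> U" "f p = 0" "\<And>x. x \<in> U \<Longrightarrow> x \<in> C \<longleftrightarrow> Im (f x) = 0" "\<And>x. x \<in> U \<Longrightarrow> x \<in> D \<longleftrightarrow> Re (f x) = 0"
    using ch unfolding chart_def by auto
  obtain s where s: "\<And>b. s b \<noteq> 0" "\<And>b x. x \<in> U \<Longrightarrow> x \<in> side D b \<longleftrightarrow> 0 < s b * Re (f x)"
    using chart_side[OF ch D] by metis
  obtain t where t: "\<And>b. t b \<noteq> 0" "\<And>b x. x \<in> U \<Longrightarrow> x \<in> side C b \<longleftrightarrow> 0 < t b * Im (f x)"
    using chart_side[OF chart_swap[OF ch] C] by auto
  obtain r g where g: "homeomorphism U (ball 0 r) f g"
    using ch unfolding chart_def by blast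
  have "C \<inter> D \<inter> U \<subseteq> {p}"
  proof
    fix x assume x: "x \<in> C \<inter> D \<inter> U"
    then have "f x = f p" using U by (auto simp: complex_eq_iff)
    then show "x \<in> {p}"
      using g x U(2) unfolding homeomorphism_def by (metis IntE singletonI)
  qed
  then have p: "C \<inter> D \<inter> U = {p}" using U by auto
  have CU: "C \<inter> U = {x \<in> U. f x \<in> {z. Im z = 0}}" using U by auto
  have CUD: "C \<inter> U \<inter> side D b = {x \<in> U. f x \<in> {z. 0 < s b * Re z \<and> Im z = 0}}" for b
    using U s by auto
  have Q: "U \<inter> side C b \<inter> side D b' = {x \<in> U. f x \<in> {z. 0 < s b' * Re z \<and> 0 < t b * Im z}}" for b b'
    using t s by auto
  have "C \<inter> U \<inter> side D b' \<subseteq> closure (U \<inter> side C b \<inter> side D b')" for b b'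
  proof
    fix x assume "x \<in> C \<inter> U \<inter> side D b'"
    then have x: "x \<in> U" "0 < s b' * Re (f x)" "Im (f x) = 0"
      using CUD by auto
    then show "x \<in> closure (U \<inter> side C b \<inter> side D b')"
      unfolding Q by (intro closure_chart[OF ch] closure_quadrant) (auto simp: s t)
  qed
  moreover have "p \<in> closure (C \<inter> U \<inter> side D b)" for b
    unfolding CUD by (intro closure_chart[OF ch]) (use U closure_axis s in auto)
  moreover have "Topological_Spaces.connected (C \<inter> U)"
    unfolding CU by (rule connected_chart[OF ch convex_sector(4)])
  moreover have "Topological_Spaces.connected (C \<inter> U \<inter> side D b)" for b
    unfolding CUD by (rule connected_chart[OF ch convex_sector(3)])
  moreover have "Topological_Spaces.connected (U \<inter> side C b \<inter> side D b')" for b b'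
    unfolding Q by (rule connected_chart[OF ch convex_sector(2)])
  ultimately show ?thesis
    unfolding branches_def using U(1,2) p by blast
qed

lemma cross_chart:
  assumes cr: "cross_at C D p" and X: "closed X" "p \<notin> X"
  obtains U f where "chart C D p U f" "U \<inter> X = {}"
proof -
  obtain W f g where W: "open W" "p \<in> W" "homeomorphism W (ball 0 1) f g" "f p = 0" and
     fC: "f ` (C \<inter> W) = {z \<in> ball 0 1. Im z = 0}" and fD: "f ` (D \<inter> W) = {z \<in> ball 0 1. Re z = 0}"
    using cr unfolding cross_at_def by blast
  have inj: "x = y" if "x \<in> W" "y \<in> W" "f x = f y" for x y
    using W(3) that unfolding homeomorphism_def by metis
  have fW: "f x \<in> ball 0 1" if "x \<in> W" for x
    using W(3) that unfolding homeomorphism_def by blast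
  have "openin (top_of_set W) (W - X)"
    using W X by (simp add: openin_open_eq open_Diff)
  then have "openin (top_of_set (ball 0 1)) (f ` (W - X))"
    using homeomorphism_imp_open_map[OF W(3)] by blast
  then have "open (f ` (W - X))"
    using openin_open_trans open_ball by blast
  moreover have "0 \<in> f ` (W - X)" using W X by (metis DiffI image_eqI)
  ultimately obtain r where r: "r > 0" "ball 0 r \<subseteq> f ` (W - X)"
    using open_contains_ball by blast
  define U where "U = W \<inter> f -` ball 0 r"
  have "continuous_on W f" using W(3) unfolding homeomorphism_def by blast
  then have "open U" unfolding U_def
    using W(1) by (intro continuous_open_preimage) auto
  have "p \<in> U" using W r by (simp add: U_def)
  have "f ` U = ball 0 r"
    using r unfolding U_def by blast
  then have "homeomorphism U (ball 0 r) f g"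
    using W(3) fW by (intro homeomorphism_of_subsets[OF W(3)]) (auto simp: U_def)
  moreover have "x \<in> C \<longleftrightarrow> Im (f x) = 0" if x: "x \<in> W" for x
  proof
    assume "Im (f x) = 0"
    then have "f x \<in> f ` (C \<inter> W)" using fC fW[OF x] by auto
    then show "x \<in> C" using inj x by blast
  qed (use fC x in blast)
  moreover have "x \<in> D \<longleftrightarrow> Re (f x) = 0" if x: "x \<in> W" for x
  proof
    assume "Re (f x) = 0"
    then have "f x \<in> f ` (D \<inter> W)" using fD fW[OF x] by auto
    then show "x \<in> D" using inj x by blast
  qed (use fD x in blast)
  ultimately have "chart C D p U f"
    using \<open>open U\<close> \<open>p \<in> U\<close> W(4) r(1) unfolding chart_def by (auto simp: U_def)
  moreover have "U \<inter> X = {}"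
    using r inj unfolding U_def by blast
  ultimately show thesis using that by blast
qed

text \<open>The end points are the first and the last point of \<open>P\<close> met when the curve
  is traversed from a point of \<open>e\<close>. They differ because \<open>P\<close> has at least
  two points.\<close>

lemma segment_ends:
  assumes C: "simple_closed_curve C" and P: "finite P" "P \<subseteq> C" "card P \<ge> 2" and e: "e \<in> components (C - P)"
  shows "card (closure e \<inter> P) = 2"
proof -
  obtain g0 where g0: "simple_path g0" "pathfinish g0 = pathstart g0" "path_image g0 = C"
    using C unfolding simple_closed_curve_def by metis
  obtain x where x: "x \<in> e" using e in_components_nonempty by blast
  have eC: "e \<subseteq> C - P" using e in_components_subset by blast
  then obtain t0 where t0: "t0 \<in> {0..1}" "x = g0 t0"
    using g0 x unfolding path_image_def by blast
  \<comment> \<open>With a start in \<open>e\<close>, the parameters of \<open>P\<close> stay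
    strictly between 0 and 1, where \<open>g\<close> is injective.\<close>
  define g where "g = shiftpath t0 g0"
  have g: "simple_path g" "path_image g = C" "g 0 = x" "g 1 = x"
    using g0 t0 simple_path_shiftpath[of g0 t0] path_image_shiftpath[of t0 g0]
      pathstart_shiftpath[of t0 g0] pathfinish_shiftpath[of t0 g0]
    unfolding g_def pathstart_def pathfinish_def by auto
  have inj: "s = t" if "0 \<le> s" "s \<le> 1" "0 < t" "t < 1" "g s = g t" for s t
    using g(1) that unfolding simple_path_def loop_free_def by fastforce
  have cont: "continuous_on {0..1} g"
    using g(1) by (simp add: simple_path_def path_def)
  define T where "T = {t \<in> {0..1}. g t \<in> P}"
  have T01: "0 < t \<and> t < 1" if "t \<in> T" for t
  proof -
    have "t \<noteq> 0" "t \<noteq> 1" using that g x eC unfolding T_def by auto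
    then show ?thesis using that unfolding T_def by auto
  qed
  have "inj_on g T"
    using inj T01 by (smt (verit) inj_onI)
  moreover have gT: "g ` T = P"
    using P g(2) unfolding T_def path_image_def by blast
  ultimately have T: "finite T" "card T \<ge> 2"
    using P finite_imageD card_image by (blast, metis)
  then have "T \<noteq> {}" by auto
  define a b where "a = Min T" and "b = Max T"
  have ab: "a \<in> T" "b \<in> T" "\<And>t. t \<in> T \<Longrightarrow> a \<le> t \<and> t \<le> b"
    using T \<open>T \<noteq> {}\<close> by (auto simp: a_def b_def)
  have "a \<noteq> b"
  proof
    assume "a = b"
    then have "T \<subseteq> {a}" using ab by force
    then show False using T card_mono[of "{a}" T] by auto
  qed
  then have "a < b" using ab by force
  have b01: "0 < a" "b < 1" using ab T01 by auto
  \<comment> \<open>Two closed pieces that meet only in \<open>P\<close>; the connected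
    \<open>e\<close> avoids \<open>P\<close> and hence stays in the piece containing
    \<open>x\<close>.\<close>
  define K1 K2 where "K1 = g ` {0..a} \<union> g ` {b..1}" and "K2 = g ` {a..b}"
  have "compact K1" "compact K2"
    unfolding K1_def K2_def using b01 \<open>a < b\<close>
    by (intro compact_Un compact_continuous_image continuous_on_subset[OF cont]; auto)+
  then have cl: "closed K1" "closed K2" by (auto intro: compact_imp_closed)
  have K12: "K1 \<union> K2 = C"
  proof -
    have "{0..1} = {0..a} \<union> {b..1} \<union> {a..b}" using b01 \<open>a < b\<close> by auto
    then show ?thesis using g(2) unfolding K1_def K2_def path_image_def by (metis image_Un)
  qed
  have meet: "K1 \<inter> K2 \<subseteq> P"
  proof
    fix y assume "y \<in> K1 \<inter> K2"
    then obtain s t where st: "s \<in> {0..a} \<union> {b..1}" "t \<in> {a..b}" "y = g s" "y = g t"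
      unfolding K1_def K2_def by blast
    then have "s = t" using inj[of s t] b01 \<open>a < b\<close> by auto
    then have "s = a \<or> s = b" using st by auto
    then show "y \<in> P" using st ab unfolding T_def by auto
  qed
  have "e \<inter> K1 \<noteq> {}" using x g(3) b01 unfolding K1_def by fastforce
  moreover have "Topological_Spaces.connected e" using e in_components_connected by blast
  ultimately have "e \<inter> K2 = {}"
    using cl meet eC K12 unfolding connected_closed by blast
  then have "e \<subseteq> K1" using eC K12 by blast
  then have "closure e \<subseteq> K1" using cl closure_minimal by blast
  have K1P: "K1 \<inter> P \<subseteq> {g a, g b}"
  proof
    fix y assume "y \<in> K1 \<inter> P"
    then obtain s where s: "s \<in> {0..a} \<union> {b..1}" "y = g s" "s \<in> T"
      unfolding K1_def T_def using b01 \<open>a < b\<close> by force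
    then have "s = a \<or> s = b" using ab(3)[OF s(3)] by auto
    then show "y \<in> {g a, g b}" using s by auto
  qed
  have sub: "g ` {0..<a} \<union> g ` {b<..1} \<subseteq> e"
  proof (rule components_maximal[OF e])
    have "Topological_Spaces.connected (g ` {0..<a})" "Topological_Spaces.connected (g ` {b<..1})"
      using b01 \<open>a < b\<close> by (intro connected_continuous_image continuous_on_subset[OF cont]; auto)+
    moreover have "g 0 \<in> g ` {0..<a}" "g 0 \<in> g ` {b<..1}"
      using b01 g(3,4) by (auto intro: image_eqI[of _ g 1])
    ultimately show "Topological_Spaces.connected (g ` {0..<a} \<union> g ` {b<..1})"
      by (intro connected_Un) auto
    show "g ` {0..<a} \<union> g ` {b<..1} \<subseteq> C - P"
    proof
      fix y assume "y \<in> g ` {0..<a} \<union> g ` {b<..1}"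
      then obtain s where s: "s \<in> {0..<a} \<union> {b<..1}" "y = g s" by blast
      then have "s \<in> {0..1}" "s \<notin> T" using b01 \<open>a < b\<close> ab(3)[of s] by auto
      then show "y \<in> C - P" using s g(2) unfolding T_def path_image_def by auto
    qed
    show "e \<inter> (g ` {0..<a} \<union> g ` {b<..1}) \<noteq> {}"
      using x g(3) b01 by fastforce
  qed
  have "g ` closure {0..<a} \<subseteq> closure e"
    using sub b01 \<open>a < b\<close> closure_subset[of e]
    by (intro image_closure_subset continuous_on_subset[OF cont]) auto
  moreover have "g ` closure {b<..1} \<subseteq> closure e"
    using sub b01 \<open>a < b\<close> closure_subset[of e]
    by (intro image_closure_subset continuous_on_subset[OF cont]) auto
  ultimately have "{g a, g b} \<subseteq> closure e"
    using b01 by auto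
  moreover have "{g a, g b} \<subseteq> P" using ab unfolding T_def by auto
  ultimately have "closure e \<inter> P = {g a, g b}"
    using \<open>closure e \<subseteq> K1\<close> K1P by blast
  moreover have "g a \<noteq> g b"
    using inj[of a b] b01 \<open>a < b\<close> by auto
  ultimately show ?thesis by simp
qed

section \<open>Segments and faces\<close>

text \<open>The inverse of the parametrisation \<open>h\<close> maps the image of \<open>g\<close>
  to a connected subset of the unit interval that contains 0 and 1.\<close>

lemma arc_subset_same_ends:
  fixes g h :: "real \<Rightarrow> complex"
  assumes "arc g" "arc h" "path_image g \<subseteq> path_image h"
    and "{pathstart g, pathfinish g} = {pathstart h, pathfinish h}"
  shows "path_image h \<subseteq> path_image g"
proof
  fix y assume y: "y \<in> path_image h"
  obtain k where k: "homeomorphism {0..1} (path_image h) h k"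
    using homeomorphism_arc[OF assms(2)] by metis
  have "Topological_Spaces.connected (k ` path_image g)"
    using k assms(1,3) continuous_on_subset unfolding homeomorphism_def
    by (intro connected_continuous_image connected_path_image arc_imp_path) blast+
  moreover have "0 \<in> k ` path_image g" "1 \<in> k ` path_image g"
  proof -
    have "h 0 \<in> path_image g" "h 1 \<in> path_image g"
      using assms(4) pathstart_in_path_image[of g] pathfinish_in_path_image[of g]
      unfolding pathstart_def pathfinish_def by (auto simp: doubleton_eq_iff)
    moreover have "k (h 0) = 0" "k (h 1) = 1"
      using k unfolding homeomorphism_def by auto
    ultimately show "0 \<in> k ` path_image g" "1 \<in> k ` path_image g" by force+
  qed
  ultimately have "{0..1} \<subseteq> k ` path_image g"
    by (rule connected_contains_Icc)
  moreover have "k y \<in> {0..1}" using k y unfolding homeomorphism_def by blast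
  ultimately obtain z where z: "z \<in> path_image g" "k y = k z" by blast
  then have "y = z" using k y assms(3) unfolding homeomorphism_def by (metis subsetD)
  then show "y \<in> path_image g" using z by simp
qed

lemma branchesD:
  assumes "branches C D p U"
  shows "open U" "p \<in> U" "p \<in> C" "p \<in> D" "C \<inter> D \<inter> U = {p}" "Topological_Spaces.connected (C \<inter> U)"
    "Topological_Spaces.connected (C \<inter> U \<inter> side D b)" "p \<in> closure (C \<inter> U \<inter> side D b)"
    "C \<inter> U \<inter> side D b \<noteq> {}" "Topological_Spaces.connected (U \<inter> side C b \<inter> side D b')"
    "C \<inter> U \<inter> side D b' \<subseteq> closure (U \<inter> side C b \<inter> side D b')"
proof -
  note B = assms[unfolded branches_def]
  show "open U" "p \<in> U" "C \<inter> D \<inter> U = {p}" "Topological_Spaces.connected (C \<inter> U)"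
    "Topological_Spaces.connected (C \<inter> U \<inter> side D b)" "p \<in> closure (C \<inter> U \<inter> side D b)"
    "Topological_Spaces.connected (U \<inter> side C b \<inter> side D b')"
    "C \<inter> U \<inter> side D b' \<subseteq> closure (U \<inter> side C b \<inter> side D b')"
    using B by blast+
  then show "p \<in> C" "p \<in> D" by blast+
  show "C \<inter> U \<inter> side D b \<noteq> {}"
    using \<open>p \<in> closure (C \<inter> U \<inter> side D b)\<close> by (metis closure_empty empty_iff)
qed

text \<open>The ends of \<open>g\<close> cut \<open>C\<close> into two arcs. Both \<open>e\<close>
  and the interior of \<open>g\<close> avoid these ends and they meet, so their union lies in one of
  the arcs, and \<open>g\<close> is all of that arc.\<close>

lemma segment_subset_arc:
  assumes C: "simple_closed_curve C" and g: "arc g" "path_image g \<subseteq> C" "pathstart g \<in> P" "pathfinish g \<in> P"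
    and e: "e \<in> components (C - P)" "e \<inter> path_image g \<noteq> {}"
  shows "e \<subseteq> path_image g"
proof -
  define a b where "a = pathstart g" and "b = pathfinish g"
  have ab: "a \<noteq> b" "a \<in> P" "b \<in> P" "a \<in> path_image g" "b \<in> path_image g"
    using g arc_distinct_ends[of g] unfolding a_def b_def by auto
  have eC: "e \<subseteq> C - P" using in_components_subset[OF e(1)] .
  obtain c where c: "simple_path c" "pathfinish c = pathstart c" "path_image c = C"
    using C unfolding simple_closed_curve_def by metis
  obtain u d where u: "arc u" "pathstart u = a" "pathfinish u = b" and d: "arc d" "pathstart d = b" "pathfinish d = a"
    and ud: "path_image u \<inter> path_image d = {a, b}" "path_image u \<union> path_image d = C"
  proof (rule exists_double_arc[OF c(1,2), of a b])
    show "a \<in> path_image c" "b \<in> path_image c" "a \<noteq> b" using ab g c(3) by auto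
  qed (use c(3) that in blast)+
  define T where "T = (path_image g - {a, b}) \<union> e"
  have T: "T \<subseteq> C - {a, b}" "path_image g \<subseteq> T \<union> {a, b}" "e \<subseteq> T"
    using g(2) eC ab unfolding T_def by auto
  have "Topological_Spaces.connected (path_image g - {a, b})"
    using connected_simple_path_endless[OF arc_imp_simple_path[OF g(1)]] unfolding a_def b_def .
  moreover have "(path_image g - {a, b}) \<inter> e \<noteq> {}"
    using e(2) eC ab by blast
  ultimately have "Topological_Spaces.connected T"
    unfolding T_def using in_components_connected[OF e(1)] connected_Un by blast
  moreover have "closed (path_image u)" "closed (path_image d)"
    using u d by (simp_all add: closed_arc_image)
  moreover have "T \<subseteq> path_image u \<union> path_image d" "path_image u \<inter> path_image d \<inter> T = {}"
    using T(1) ud by auto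
  ultimately have "path_image u \<inter> T = {} \<or> path_image d \<inter> T = {}"
    unfolding connected_closed by blast
  then show ?thesis
  proof
    assume "path_image d \<inter> T = {}"
    then have sub: "T \<subseteq> path_image u" using T ud by blast
    moreover have "{a, b} \<subseteq> path_image u" using ud by blast
    ultimately have "path_image g \<subseteq> path_image u" using T by blast
    then have "path_image u \<subseteq> path_image g"
      using arc_subset_same_ends[OF g(1) u(1)] u(2,3) unfolding a_def b_def by simp
    then show ?thesis using T sub by blast
  next
    assume "path_image u \<inter> T = {}"
    then have sub: "T \<subseteq> path_image d" using T ud by blast
    moreover have "{a, b} \<subseteq> path_image d" using ud by blast
    ultimately have "path_image g \<subseteq> path_image d" using T by blast
    then have "path_image d \<subseteq> path_image g"
      using arc_subset_same_ends[OF g(1) d(1)] d(2,3) unfolding a_def b_def by (simp add: insert_commute)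
    then show ?thesis using T sub by blast
  qed
qed

section \<open>Crossings and segments of a system of curves\<close>

locale curves =
  fixes \<C> :: "complex set set"
  assumes curve_system: "curve_system \<C>"
begin

abbreviation P :: "complex set" where
  "P \<equiv> crossings \<C>"

definition segs :: "complex set \<Rightarrow> complex set set" where
  "segs C = components (C - P)"

lemma finite_curves: "finite \<C>" and card_curves: "3 \<le> card \<C>"
  and curve: "C \<in> \<C> \<Longrightarrow> simple_closed_curve C"
  and connected_curves: "Topological_Spaces.connected (\<Union>\<C>)"
  and finite_crossings: "finite P"
  and at_most_two: "card {C \<in> \<C>. p \<in> C} \<le> 2"
  and crossing: "C \<in> \<C> \<Longrightarrow> D \<in> \<C> \<Longrightarrow> C \<noteq> D \<Longrightarrow> p \<in> C \<Longrightarrow> p \<in> D \<Longrightarrow> cross_at C D p"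
  using curve_system unfolding curve_system_def general_position_def by auto

lemma crossingI: "C \<in> \<C> \<Longrightarrow> D \<in> \<C> \<Longrightarrow> C \<noteq> D \<Longrightarrow> p \<in> C \<Longrightarrow> p \<in> D \<Longrightarrow> p \<in> P"
  unfolding crossings_def by blast

lemma only_two_curves:
  assumes "C \<in> \<C>" "D \<in> \<C>" "C \<noteq> D" "p \<in> C" "p \<in> D" "X \<in> \<C>" "p \<in> X"
  shows "X = C \<or> X = D"
proof (rule ccontr)
  assume "\<not> ?thesis"
  then have "card {C, D, X} = 3" using assms(3) by (metis card_3_iff)
  moreover have "card {C, D, X} \<le> card {C \<in> \<C>. p \<in> C}"
    using assms finite_curves by (intro card_mono) auto
  ultimately show False using at_most_two[of p] by simp
qed

lemma other_curve_at:
  assumes "C \<in> \<C>" "p \<in> C" "p \<in> P"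
  obtains D where "D \<in> \<C>" "C \<noteq> D" "p \<in> D"
  using assms unfolding crossings_def by (smt (verit) Int_iff mem_Collect_eq)

lemma closed_Union_curves:
  assumes "X \<subseteq> \<C>"
  shows "closed (\<Union>X)"
proof (rule closed_Union)
  show "finite X" using finite_subset[OF assms finite_curves] .
  show "\<forall>C\<in>X. closed C"
    using assms curve simple_closed_curveD(1) compact_imp_closed by blast
qed

lemma nbhd:
  assumes C: "C \<in> \<C>" "D \<in> \<C>" "C \<noteq> D" "p \<in> C" "p \<in> D"
  obtains U where "branches C D p U" "branches D C p U" "P \<inter> U = {p}"
    "\<forall>X\<in>\<C>. X \<inter> U \<noteq> {} \<longrightarrow> X = C \<or> X = D"
proof -
  define R where "R = \<Union>(\<C> - {C, D})"
  have "closed R"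
    unfolding R_def by (rule closed_Union_curves) blast
  moreover have "p \<notin> R"
    using only_two_curves[OF C] unfolding R_def by blast
  ultimately obtain U f where U: "chart C D p U f" "U \<inter> R = {}"
    using cross_chart[OF crossing[OF C]] by metis
  have b: "branches C D p U" "branches D C p U"
    using branches_chart[OF U(1)] branches_chart[OF chart_swap[OF U(1)]] curve C by auto
  have only: "\<forall>X\<in>\<C>. X \<inter> U \<noteq> {} \<longrightarrow> X = C \<or> X = D"
    using U(2) unfolding R_def by blast
  have "P \<inter> U = {p}"
  proof
    show "P \<inter> U \<subseteq> {p}"
    proof
      fix x assume "x \<in> P \<inter> U"
      then obtain X Y where "X \<in> \<C>" "Y \<in> \<C>" "X \<noteq> Y" "x \<in> X" "x \<in> Y" "x \<in> U"
        unfolding crossings_def by blast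
      then have "x \<in> C \<inter> D \<inter> U" using only by blast
      then show "x \<in> {p}" using branchesD(5)[OF b(1)] by blast
    qed
    show "{p} \<subseteq> P \<inter> U" using branchesD(2-4)[OF b(1)] crossingI[OF C] by blast
  qed
  then show thesis using that b only by blast
qed

lemma segs:
  assumes C: "C \<in> \<C>" and e: "e \<in> segs C"
  shows "e \<subseteq> C - P" "e \<noteq> {}" "Topological_Spaces.connected e" "closure e \<subseteq> C" "closure e - P = e"
    "D \<in> \<C> \<Longrightarrow> D \<noteq> C \<Longrightarrow> e \<inter> D = {}"
proof -
  have e: "e \<in> components (C - P)" using e unfolding segs_def .
  show sub: "e \<subseteq> C - P" and "e \<noteq> {}" and "Topological_Spaces.connected e"
    using in_components_subset[OF e] in_components_nonempty[OF e] in_components_connected[OF e] by auto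
  show cl: "closure e \<subseteq> C"
    using sub simple_closed_curveD(1)[OF curve[OF C]] by (intro closure_minimal compact_imp_closed) auto
  show "closure e - P = e"
  proof
    obtain T where T: "closed T" "e = (C - P) \<inter> T"
      using closedin_component[OF e] unfolding closedin_closed by auto
    then have "closure e \<subseteq> T" by (intro closure_minimal) auto
    then show "closure e - P \<subseteq> e" using T cl by blast
  qed (use sub closure_subset in blast)
  show "e \<inter> D = {}" if "D \<in> \<C>" "D \<noteq> C"
    using sub crossingI[OF that(1) C that(2)] by blast
qed

lemma segs_disjoint:
  assumes "C \<in> \<C>" "D \<in> \<C>" "e \<in> segs C" "f \<in> segs D" "e \<inter> f \<noteq> {}"
  shows "C = D" "e = f"
proof -
  show CD: "C = D"
    using segs(1,6) assms by blast
  show "e = f"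
    using components_nonoverlap[of e "C - P" f] assms CD unfolding segs_def by blast
qed

text \<open>A segment of \<open>C\<close> misses \<open>D\<close> and so stays on one side of it,
  whereas the branches of \<open>C\<close> at \<open>p\<close> lie on opposite sides. Hence they
  belong to different segments, and no segment returns to \<open>p\<close>.\<close>

lemma segs_at:
  assumes C: "C \<in> \<C>" "D \<in> \<C>" "C \<noteq> D" and br: "branches C D p U" and PU: "P \<inter> U = {p}"
  obtains e where "\<forall>b. e b \<in> segs C \<and> C \<inter> U \<inter> side D b \<subseteq> e b \<and> e b \<subseteq> side D b"
    "{x \<in> segs C. p \<in> closure x} = {e True, e False}" "e True \<noteq> e False"
proof -
  note D = side[OF curve[OF C(2)]]
  note p = branchesD(3,4,2,1)[OF br]
  have "\<exists>e. e \<in> segs C \<and> C \<inter> U \<inter> side D b \<subseteq> e \<and> e \<subseteq> side D b" for b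
  proof -
    note con = branchesD(7)[OF br, of b] and ne = branchesD(9)[OF br, of b]
    have sub: "C \<inter> U \<inter> side D b \<subseteq> C - P"
    proof
      fix x assume x: "x \<in> C \<inter> U \<inter> side D b"
      then have "x \<noteq> p" using D(2)[of b] p(2) by blast
      then show "x \<in> C - P" using x PU by blast
    qed
    have "C - P \<noteq> {}" using ne sub by blast
    then obtain e where e: "e \<in> segs C" "C \<inter> U \<inter> side D b \<subseteq> e"
      using exists_component_superset[OF sub _ con] unfolding segs_def by metis
    have "e \<inter> D = {}" using segs(6)[OF C(1) e(1) C(2)] C(3) by simp
    then obtain b' where b': "e \<subseteq> side D b'"
      using connected_side[OF curve[OF C(2)] segs(3)[OF C(1) e(1)]] by metis
    obtain x where "x \<in> C \<inter> U \<inter> side D b" using ne by blast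
    then have "b' = b"
      using e(2) b' D(5)[of x b' b] by blast
    then show ?thesis using e b' by blast
  qed
  then obtain e where e: "\<forall>b. e b \<in> segs C \<and> C \<inter> U \<inter> side D b \<subseteq> e b \<and> e b \<subseteq> side D b"
    by metis
  have cl: "p \<in> closure (e b)" for b
  proof -
    have "p \<in> closure (C \<inter> U \<inter> side D b)" by (rule branchesD(8)[OF br])
    then show ?thesis using closure_mono[of "C \<inter> U \<inter> side D b" "e b"] e by blast
  qed
  have "x \<in> {e True, e False}" if x: "x \<in> segs C" "p \<in> closure x" for x
  proof -
    have "U \<inter> x \<noteq> {}"
      using p x(2) open_Int_closure_eq_empty[OF p(4), of x] by blast
    then obtain y where y: "y \<in> U" "y \<in> x" by blast
    have "y \<in> C" "y \<notin> D" using y segs(1)[OF C(1) x(1)] segs(6)[OF C(1) x(1) C(2)] C(3) by blast+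
    then obtain b where "y \<in> side D b" using D(4) by blast
    then have "y \<in> e b" using e y \<open>y \<in> C\<close> by blast
    then have "x = e b" using segs_disjoint(2)[OF C(1) C(1) x(1), of "e b"] e y(2) by blast
    then show ?thesis by (cases b) auto
  qed
  then have "{x \<in> segs C. p \<in> closure x} = {e True, e False}"
    using e cl by blast
  moreover have "e True \<noteq> e False"
  proof
    assume "e True = e False"
    then have "e True \<subseteq> side D True \<inter> side D False" using e by (metis Int_greatest)
    then show False using D(3) segs(2)[OF C(1), of "e True"] e by blast
  qed
  ultimately show thesis using that e by blast
qed

lemma degree_two:
  assumes "C \<in> \<C>" "p \<in> C" "p \<in> P"
  shows "card {e \<in> segs C. p \<in> closure e} = 2"
proof -
  obtain D where D: "D \<in> \<C>" "C \<noteq> D" "p \<in> D" using other_curve_at assms by metis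
  obtain U where "branches C D p U" "P \<inter> U = {p}"
    using nbhd[OF assms(1) D(1,2) assms(2) D(3)] by metis
  then obtain e where "{x \<in> segs C. p \<in> closure x} = {e True, e False}" "e True \<noteq> e False"
    using segs_at[OF assms(1) D(1,2)] by metis
  then show ?thesis by simp
qed

lemma curves_meet:
  assumes X: "X \<subseteq> \<C>" "X \<noteq> {}" "X \<noteq> \<C>"
  shows "\<exists>C\<in>X. \<exists>D\<in>\<C> - X. C \<inter> D \<noteq> {}"
proof (rule ccontr)
  assume "\<not> ?thesis"
  then have "\<Union>X \<inter> \<Union>(\<C> - X) = {}" by blast
  moreover have "closed (\<Union>X)" "closed (\<Union>(\<C> - X))"
    using closed_Union_curves X by auto
  moreover have "\<Union>\<C> = \<Union>X \<union> \<Union>(\<C> - X)" using X by blast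
  ultimately have "\<Union>X = {} \<or> \<Union>(\<C> - X) = {}"
    using connected_closedD[OF connected_curves, of "\<Union>X" "\<Union>(\<C> - X)"] by auto
  then obtain C where "C \<in> \<C>" "C = {}"
    using X by blast
  then show False
    using curve simple_closed_curveD(3) by blast
qed

text \<open>With a single crossing \<open>p\<close>, removing it would leave \<open>C\<close>
  connected, hence one segment, but two segments meet at \<open>p\<close>. Parity of crossings
  cannot be used here, since its proof needs two ends for each segment.\<close>

lemma two_crossings:
  assumes C: "C \<in> \<C>"
  shows "card (C \<inter> P) \<ge> 2"
proof (rule ccontr)
  assume small: "\<not> card (C \<inter> P) \<ge> 2"
  have "{C} \<noteq> \<C>" using card_curves by auto
  then obtain D p where D: "D \<in> \<C>" "C \<noteq> D" "p \<in> C" "p \<in> D"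
    using curves_meet[of "{C}"] C by blast
  have p: "p \<in> C \<inter> P" using crossingI C D by blast
  have "finite (C \<inter> P)" using finite_crossings by simp
  then have CP: "C \<inter> P = {p}"
    using p small card_seteq[of "C \<inter> P" "{p}"] by auto
  obtain g0 where g0: "simple_path g0" "pathfinish g0 = pathstart g0" "path_image g0 = C"
    using curve[OF C] unfolding simple_closed_curve_def by metis
  then obtain t0 where t0: "t0 \<in> {0..1}" "p = g0 t0"
    using D unfolding path_image_def by blast
  \<comment> \<open>The loop is rotated to start at \<open>p\<close>, so the two ends removed from
    the path are both \<open>p\<close>.\<close>
  have "Topological_Spaces.connected (path_image (shiftpath t0 g0) - {p, p})"
    using connected_simple_path_endless[of "shiftpath t0 g0"] simple_path_shiftpath[of g0 t0] g0 t0
      pathstart_shiftpath[of t0 g0] pathfinish_shiftpath[of t0 g0] by auto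
  moreover have "path_image (shiftpath t0 g0) = C"
    using path_image_shiftpath[of t0 g0] g0 t0 by auto
  moreover have "C - P = C - {p, p}" using CP by blast
  ultimately have "Topological_Spaces.connected (C - P)" by simp
  then have single: "e = C - P" if "e \<in> segs C" for e
    using that components_maximal[of e "C - P" "C - P"] segs(1,2)[OF C that] unfolding segs_def by blast
  have "card {x \<in> segs C. p \<in> closure x} = 2"
    using degree_two[OF C] p by blast
  then obtain e e' where e: "{x \<in> segs C. p \<in> closure x} = {e, e'}" "e \<noteq> e'"
    unfolding card_2_iff by blast
  then have "e \<in> segs C" "e' \<in> segs C" by blast+
  then show False using single e(2) by metis
qed

lemma card_ends_seg:
  assumes "C \<in> \<C>" "e \<in> segs C"
  shows "card (closure e \<inter> P) = 2"
proof -
  have "C - C \<inter> P = C - P" by blast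
  then have "card (closure e \<inter> (C \<inter> P)) = 2"
    using segment_ends[of C "C \<inter> P" e] curve assms finite_crossings two_crossings[OF assms(1)]
    unfolding segs_def by simp
  moreover have "closure e \<inter> (C \<inter> P) = closure e \<inter> P" using segs(4)[OF assms] by blast
  ultimately show ?thesis by simp
qed

lemma finite_segs:
  assumes "C \<in> \<C>"
  shows "finite (segs C)"
proof (rule finite_subset)
  show "segs C \<subseteq> (\<Union>p\<in>C \<inter> P. {e \<in> segs C. p \<in> closure e})"
  proof
    fix e assume e: "e \<in> segs C"
    then have "closure e \<inter> P \<noteq> {}" using card_ends_seg[OF assms] by fastforce
    then show "e \<in> (\<Union>p\<in>C \<inter> P. {e \<in> segs C. p \<in> closure e})"
      using segs(4)[OF assms e] e by blast
  qed
  have "finite {e \<in> segs C. p \<in> closure e}" if "p \<in> C \<inter> P" for p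
    using degree_two[OF assms] that by (intro card_ge_0_finite) auto
  then show "finite (\<Union>p\<in>C \<inter> P. {e \<in> segs C. p \<in> closure e})"
    using finite_crossings by blast
qed

text \<open>Among the segments of \<open>C\<close> inside \<open>D\<close>, a crossing on
  \<open>D\<close> has degree one, since the branches of \<open>C\<close> lie on opposite sides. A
  crossing of \<open>C\<close> with another curve has degree zero or two, since both branches lie on
  the same side of \<open>D\<close>. The handshake lemma counts the former.\<close>

lemma even_common_crossings:
  assumes C: "C \<in> \<C>" "D \<in> \<C>" "C \<noteq> D"
  shows "even (card (C \<inter> D))"
proof -
  define M where "M = {e \<in> segs C. e \<subseteq> side D True}"
  have deg: "odd (card {e \<in> M. p \<in> closure e \<inter> P}) \<longleftrightarrow> p \<in> C \<inter> D" if p: "p \<in> P" for p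
  proof (cases "p \<in> C")
    case False
    then have eq: "{e \<in> M. p \<in> closure e \<inter> P} = {}"
      using segs(4)[OF C(1)] unfolding M_def by blast
    show ?thesis unfolding eq using False by simp
  next
    case pC: True
    show ?thesis
    proof (cases "p \<in> D")
      case True
      obtain U where U: "branches C D p U" "P \<inter> U = {p}"
        using nbhd[OF C pC True] by metis
      obtain e where e: "\<forall>b. e b \<in> segs C \<and> C \<inter> U \<inter> side D b \<subseteq> e b \<and> e b \<subseteq> side D b"
        "{x \<in> segs C. p \<in> closure x} = {e True, e False}" "e True \<noteq> e False"
        by (rule segs_at[OF C U])
      have "\<not> e False \<subseteq> side D True"
        using e(1) segs(2)[OF C(1)] side(3)[OF curve[OF C(2)]] by blast
      then have eq: "{x \<in> M. p \<in> closure x \<inter> P} = {e True}"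
        using e p unfolding M_def by blast
      show ?thesis unfolding eq using True pC by simp
    next
      case False
      obtain Y where Y: "Y \<in> \<C>" "C \<noteq> Y" "p \<in> Y" using other_curve_at[OF C(1) pC p] by metis
      obtain U where U: "branches C Y p U" "P \<inter> U = {p}" "\<forall>X\<in>\<C>. X \<inter> U \<noteq> {} \<longrightarrow> X = C \<or> X = Y"
        using nbhd[OF C(1) Y(1,2) pC Y(3)] by metis
      obtain e where e: "\<forall>b. e b \<in> segs C \<and> C \<inter> U \<inter> side Y b \<subseteq> e b \<and> e b \<subseteq> side Y b"
        "{x \<in> segs C. p \<in> closure x} = {e True, e False}" "e True \<noteq> e False"
        by (rule segs_at[OF C(1) Y(1,2) U(1,2)])
      have "D \<inter> U = {}" using U(3) C Y False by blast
      moreover have "Topological_Spaces.connected (C \<inter> U)" by (rule branchesD(6)[OF U(1)])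
      ultimately obtain b where b: "C \<inter> U \<subseteq> side D b"
        using connected_side[OF curve[OF C(2)], of "C \<inter> U"] by blast
      have eb: "e c \<subseteq> side D b" for c
      proof -
        obtain b' where b': "e c \<subseteq> side D b'"
          using connected_side[OF curve[OF C(2)], of "e c"] segs[OF C(1)] e(1) C by metis
        have "C \<inter> U \<inter> side Y c \<noteq> {}" by (rule branchesD(9)[OF U(1)])
        then obtain y where "y \<in> C \<inter> U" "y \<in> e c" using e(1) by blast
        then have "b' = b" using b b' side(5)[OF curve[OF C(2)]] by blast
        then show ?thesis using b' by simp
      qed
      show ?thesis
      proof (cases b)
        case True
        then have eD: "e c \<in> M" for c using e(1) eb[of c] unfolding M_def by simp
        have eq: "{x \<in> M. p \<in> closure x \<inter> P} = {e True, e False}"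
        proof
          show "{x \<in> M. p \<in> closure x \<inter> P} \<subseteq> {e True, e False}"
            using e(2) unfolding M_def by blast
          have "p \<in> closure (e True)" "p \<in> closure (e False)" using e(2) by blast+
          then show "{e True, e False} \<subseteq> {x \<in> M. p \<in> closure x \<inter> P}"
            using eD p by blast
        qed
        show ?thesis unfolding eq using False e(3) by simp
      next
        case b: False
        have "\<not> e c \<subseteq> side D True" for c
          using eb[of c] b e(1) segs(2)[OF C(1)] side(3)[OF curve[OF C(2)]] by fastforce
        then have eq: "{x \<in> M. p \<in> closure x \<inter> P} = {}"
          using e(2) unfolding M_def by blast
        show ?thesis unfolding eq using False by simp
      qed
    qed
  qed
  have "{p \<in> P. odd (card {e \<in> M. p \<in> closure e \<inter> P})} = C \<inter> D"
    using deg crossingI[OF C] by blast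
  moreover have "even (card {p \<in> P. odd (card {e \<in> M. p \<in> closure e \<inter> P})})"
    using finite_segs[OF C(1)] finite_crossings card_ends_seg[OF C(1)]
    by (intro even_card_odd_degree) (auto simp: M_def)
  ultimately show ?thesis by simp
qed

lemma closure_segs_Union:
  assumes "C \<in> \<C>"
  shows "C = (\<Union>e\<in>segs C. closure e)"
proof
  show "C \<subseteq> (\<Union>e\<in>segs C. closure e)"
  proof
    fix x assume x: "x \<in> C"
    show "x \<in> (\<Union>e\<in>segs C. closure e)"
    proof (cases "x \<in> P")
      case True
      then have "{e \<in> segs C. x \<in> closure e} \<noteq> {}" using degree_two[OF assms x] by fastforce
      then show ?thesis by blast
    next
      case False
      then obtain e where "e \<in> segs C" "x \<in> e"
        using x Union_components[of "C - P"] unfolding segs_def by blast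
      then show ?thesis using closure_subset by blast
    qed
  qed
qed (use segs(4)[OF assms] in blast)

text \<open>Otherwise the closures of the segments in \<open>X\<close> and of the others would split
  \<open>C\<close> into two disjoint closed parts: a common point is no crossing by hypothesis, and
  elsewhere segments are disjoint.\<close>

lemma segs_connected:
  assumes C: "C \<in> \<C>" and X: "X \<subseteq> segs C" "X \<noteq> {}"
    and closed: "\<And>p e e'. e \<in> X \<Longrightarrow> e' \<in> segs C \<Longrightarrow> p \<in> closure e \<inter> P \<Longrightarrow> p \<in> closure e' \<inter> P \<Longrightarrow> e' \<in> X"
  shows "X = segs C"
proof (rule ccontr)
  assume "X \<noteq> segs C"
  define K1 K2 where "K1 = (\<Union>e\<in>X. closure e)" and "K2 = (\<Union>e\<in>segs C - X. closure e)"
  have "closed K1" "closed K2"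
    unfolding K1_def K2_def using finite_segs[OF C] finite_subset[OF X(1)] by auto
  moreover have "C \<subseteq> K1 \<union> K2"
    using closure_segs_Union[OF C] X unfolding K1_def K2_def by blast
  moreover have "K1 \<inter> K2 = {}"
  proof (rule ccontr)
    assume "K1 \<inter> K2 \<noteq> {}"
    then obtain x e e' where x: "e \<in> X" "e' \<in> segs C - X" "x \<in> closure e" "x \<in> closure e'"
      unfolding K1_def K2_def by blast
    have "x \<notin> P" using x closed by blast
    then have "x \<in> e" "x \<in> e'" using segs(5)[OF C] x X by blast+
    then show False using segs_disjoint(2)[OF C C, of e e'] x X by blast
  qed
  ultimately have "K1 \<inter> C = {} \<or> K2 \<inter> C = {}"
    using simple_closed_curveD(2)[OF curve[OF C]] unfolding connected_closed by blast
  moreover have "closure e \<inter> C \<noteq> {}" if "e \<in> segs C" for e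
    using segs(1,2)[OF C that] closure_subset[of e] by blast
  ultimately show False
    using X \<open>X \<noteq> segs C\<close> unfolding K1_def K2_def by blast
qed

section \<open>Faces near a crossing\<close>

lemma face:
  assumes "F \<in> faces \<C>"
  shows "Topological_Spaces.connected F" "F \<inter> \<Union>\<C> = {}" "open F" "F \<noteq> {}"
proof -
  have F: "F \<in> components (- \<Union>\<C>)" using assms unfolding faces_def .
  show "Topological_Spaces.connected F" "F \<inter> \<Union>\<C> = {}" "F \<noteq> {}"
    using in_components_connected[OF F] in_components_subset[OF F] in_components_nonempty[OF F] by auto
  have "closed (\<Union>\<C>)"
    by (rule closed_Union_curves) simp
  then show "open F" using open_components[OF _ F] by auto
qed

text \<open>A face meets a neighbourhood of a crossing in at most one of the four quadrants, because the
  quadrants are distinguished by the sides of the two curves.\<close>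

lemma face_quadrant:
  assumes C: "C \<in> \<C>" "D \<in> \<C>" and br: "branches C D p U"
    and only: "\<forall>X\<in>\<C>. X \<inter> U \<noteq> {} \<longrightarrow> X = C \<or> X = D"
    and F: "F \<in> faces \<C>" "F \<inter> U \<noteq> {}"
  obtains b b' where "F \<subseteq> side C b \<inter> side D b'" "U \<inter> side C b \<inter> side D b' \<subseteq> F"
proof -
  obtain b where b: "F \<subseteq> side C b"
    using connected_side[OF curve[OF C(1)], of F] face[OF F(1)] C by blast
  obtain b' where b': "F \<subseteq> side D b'"
    using connected_side[OF curve[OF C(2)], of F] face[OF F(1)] C by blast
  have "U \<inter> side C b \<inter> side D b' \<subseteq> F"
  proof (rule components_maximal)
    show "F \<in> components (- \<Union>\<C>)" using F unfolding faces_def by simp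
    show "Topological_Spaces.connected (U \<inter> side C b \<inter> side D b')"
      by (rule branchesD(10)[OF br])
    show "U \<inter> side C b \<inter> side D b' \<subseteq> - \<Union>\<C>"
      using only side(2)[OF curve[OF C(1)], of b] side(2)[OF curve[OF C(2)], of b'] by blast
    show "F \<inter> (U \<inter> side C b \<inter> side D b') \<noteq> {}" using F b b' by blast
  qed
  then show thesis using that b b' by blast
qed

lemma quadrant_face:
  assumes C: "C \<in> \<C>" "D \<in> \<C>" and br: "branches C D p U"
    and only: "\<forall>X\<in>\<C>. X \<inter> U \<noteq> {} \<longrightarrow> X = C \<or> X = D"
  obtains F where "F \<in> faces \<C>" "U \<inter> side C b \<inter> side D b' \<subseteq> F"
proof -
  have "U \<inter> side C b \<inter> side D b' \<noteq> {}"
    using branchesD(9,11)[OF br] by (metis closure_empty subset_empty)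
  moreover have "U \<inter> side C b \<inter> side D b' \<subseteq> - \<Union>\<C>"
    using only side(2)[OF curve[OF C(1)], of b] side(2)[OF curve[OF C(2)], of b'] by blast
  ultimately show thesis
    using exists_component_superset[of "U \<inter> side C b \<inter> side D b'" "- \<Union>\<C>"] branchesD(10)[OF br] that
    unfolding faces_def by blast
qed

lemma branch_frontier:
  assumes C: "C \<in> \<C>" and br: "branches C D p U" and F: "F \<in> faces \<C>" "U \<inter> side C b \<inter> side D b' \<subseteq> F"
  shows "C \<inter> U \<inter> side D b' \<subseteq> frontier F"
proof
  fix x assume x: "x \<in> C \<inter> U \<inter> side D b'"
  then have "x \<in> closure (U \<inter> side C b \<inter> side D b')"
    using branchesD(11)[OF br] by blast
  then have "x \<in> closure F" using closure_mono[OF F(2)] by blast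
  moreover have "x \<notin> F" using x face(2)[OF F(1)] C by blast
  ultimately show "x \<in> frontier F"
    using face(3)[OF F(1)] by (simp add: frontier_def interior_open)
qed

text \<open>If \<open>x\<close> is off \<open>D\<close>, the open side of \<open>D\<close> around it
  meets \<open>F\<close>, hence is the side of \<open>F\<close>. So a face that follows
  \<open>C\<close> cannot pass the crossing \<open>p\<close> along \<open>C\<close>.\<close>

lemma frontier_branch:
  assumes C: "D \<in> \<C>" and br: "branches C D p U" and F: "F \<subseteq> side D b'"
    and x: "x \<in> C \<inter> U \<inter> frontier F"
  shows "x = p \<or> x \<in> side D b'"
proof (cases "x \<in> D")
  case True
  then show ?thesis using branchesD(5)[OF br] x by blast
next
  case False
  note D = side[OF curve[OF C]]
  obtain c where c: "x \<in> side D c" using D(4)[OF False] by blast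
  have "side D c \<inter> F \<noteq> {}"
    using open_Int_closure_eq_empty[OF D(1), of c F] c x unfolding frontier_def by blast
  then have "c = b'" using F D(5) by blast
  then show ?thesis using c by simp
qed

end

section \<open>Consequences of unique face incidence\<close>

locale V_curves = curves +
  assumes ufi: "unique_face_incidence \<C>"
begin

lemma frontier_arc:
  assumes "F \<in> faces \<C>" "C \<in> \<C>" "frontier F \<inter> C \<noteq> {}"
  obtains g where "arc g" "path_image g = frontier F \<inter> C" "pathstart g \<in> P" "pathfinish g \<in> P"
  using assms ufi unfolding unique_face_incidence_def by blast

text \<open>That the arc of UFI ends at crossings is decisive: it then contains every segment it
  meets, without any local analysis along the segment.\<close>

lemma frontier_segment:
  assumes "F \<in> faces \<C>" "C \<in> \<C>" "e \<in> segs C" "e \<inter> frontier F \<noteq> {}"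
  shows "e \<subseteq> frontier F"
proof -
  have "frontier F \<inter> C \<noteq> {}" using assms segs(1) by blast
  then obtain g where g: "arc g" "path_image g = frontier F \<inter> C" "pathstart g \<in> P" "pathfinish g \<in> P"
    using frontier_arc assms by metis
  then show ?thesis
    using segment_subset_arc[OF curve[OF assms(2)] g(1) _ g(3,4), of e] assms segs(1)
    unfolding segs_def by blast
qed

text \<open>UFI itself allows an arc of several segments. But \<open>closure e\<close> is open as
  well as closed in the connected set \<open>A\<close>: at an end of \<open>e\<close> the face turns
  off, so \<open>A\<close> does not go on along \<open>C\<close>.\<close>

lemma frontier_one_segment:
  assumes F: "F \<in> faces \<C>" and C: "C \<in> \<C>" and e: "e \<in> segs C" "e \<subseteq> frontier F"
    and e': "e' \<in> segs C" "e' \<subseteq> frontier F"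
  shows "e = e'"
proof -
  define A where "A = frontier F \<inter> C"
  have "A \<noteq> {}" using e segs(1,2)[OF C e(1)] unfolding A_def by blast
  then obtain g where "arc g" "path_image g = A"
    using frontier_arc F C unfolding A_def by metis
  then have conn: "Topological_Spaces.connected A"
    using connected_path_image arc_imp_path by blast
  have eA: "e \<subseteq> A" "e' \<subseteq> A" using e e' segs(1)[OF C] unfolding A_def by auto
  \<comment> \<open>The largest open set whose trace on \<open>A\<close> stays in
    \<open>closure e\<close>; containing \<open>closure e\<close>, it shows that set to be
    relatively open.\<close>
  define W where "W = \<Union>{W. open W \<and> W \<inter> A \<subseteq> closure e}"
  have "open W" unfolding W_def by auto
  have "x \<in> W" if x: "x \<in> closure e" for x
  proof (cases "x \<in> P")
    case True
    have xC: "x \<in> C" using segs(4)[OF C e(1)] x by blast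
    obtain D where D: "D \<in> \<C>" "C \<noteq> D" "x \<in> D" using other_curve_at[OF C xC True] by metis
    obtain U where U: "branches C D x U" "P \<inter> U = {x}" "\<forall>X\<in>\<C>. X \<inter> U \<noteq> {} \<longrightarrow> X = C \<or> X = D"
      using nbhd[OF C D(1,2) xC D(3)] by metis
    note oU = branchesD(1,2)[OF U(1)]
    obtain s where s: "\<forall>b. s b \<in> segs C \<and> C \<inter> U \<inter> side D b \<subseteq> s b \<and> s b \<subseteq> side D b"
        "{y \<in> segs C. x \<in> closure y} = {s True, s False}" "s True \<noteq> s False"
      by (rule segs_at[OF C D(1,2) U(1,2)])
    have "e \<in> {s True, s False}" using s(2) e(1) x by blast
    then obtain c where c: "e = s c" by blast
    have "x \<in> frontier F"
      using closure_minimal[OF e(2)] x by (auto simp: frontier_closed)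
    then have "F \<inter> U \<noteq> {}"
      using open_Int_closure_eq_empty[OF oU(1), of F] oU(2) unfolding frontier_def by blast
    \<comment> \<open>In one quadrant only, \<open>F\<close> borders just one branch of
      \<open>C\<close> at \<open>x\<close>, which turns out to be that of \<open>e\<close>.\<close>
    then obtain b b' where b: "F \<subseteq> side C b \<inter> side D b'"
      using face_quadrant[OF C D(1) U(1,3) F] by metis
    have on_side: "y = x \<or> y \<in> side D b'" if "y \<in> C \<inter> U \<inter> frontier F" for y
      using frontier_branch[OF D(1) U(1) _ that] b by blast
    obtain y where y: "y \<in> C \<inter> U \<inter> side D c" using branchesD(9)[OF U(1), of c] by blast
    then have "y \<in> frontier F" "y \<noteq> x"
      using s(1) c e(2) side(2)[OF curve[OF D(1)], of c] D(3) by blast+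
    then have "b' = c" using on_side[of y] y side(5)[OF curve[OF D(1)]] by blast
    then have "U \<inter> A \<subseteq> insert x e"
      using on_side s(1) c unfolding A_def by blast
    then have "U \<inter> A \<subseteq> closure e" using x closure_subset by blast
    then show ?thesis using oU unfolding W_def by blast
  next
    case False
    then have xe: "x \<in> e" using segs(5)[OF C e(1)] x by blast
    define N where "N = - (P \<union> (\<Union>f\<in>segs C - {e}. closure f))"
    have "closed (P \<union> (\<Union>f\<in>segs C - {e}. closure f))"
      using finite_segs[OF C] finite_crossings by (intro closed_Un closed_UN) (auto intro: finite_imp_closed)
    then have "open N" unfolding N_def by (rule open_Compl)
    moreover have "x \<in> N"
    proof -
      have "x \<notin> closure f" if "f \<in> segs C - {e}" for f
        using segs(5)[OF C, of f] segs_disjoint(2)[OF C C e(1), of f] that xe False by blast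
      then show ?thesis unfolding N_def using False by blast
    qed
    moreover have "N \<inter> A \<subseteq> closure e"
      using closure_segs_Union[OF C] unfolding N_def A_def by blast
    ultimately show ?thesis unfolding W_def by blast
  qed
  then have W: "closure e \<subseteq> W" by blast
  have "A \<subseteq> W \<union> - closure e" "W \<inter> - closure e \<inter> A = {}"
    using W unfolding W_def by blast+
  moreover have "W \<inter> A \<noteq> {}" using W eA segs(2)[OF C e(1)] closure_subset[of e] by blast
  ultimately have "- closure e \<inter> A = {}"
    using connectedD[OF conn \<open>open W\<close>, of "- closure e"] by auto
  then have "e' \<subseteq> e" using eA segs(1)[OF C e'(1)] segs(5)[OF C e(1)] by blast
  then show ?thesis
    using segs_disjoint(2)[OF C C e(1) e'(1)] segs(2)[OF C e'(1)] by blast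
qed

text \<open>The condition on \<open>F\<close> sits inside the set, so that other arguments have
  empty border and the locale axioms hold for them too.\<close>

definition border :: "complex set \<Rightarrow> complex set set" where
  "border F = {e \<in> \<Union>(segs ` \<C>). F \<in> faces \<C> \<and> e \<subseteq> frontier F}"

lemma segment_branch:
  assumes s: "\<forall>b. s b \<in> segs C \<and> C \<inter> U \<inter> side D b \<subseteq> s b \<and> s b \<subseteq> side D b"
    and br: "branches C D p U" and C: "C \<in> \<C>"
    and F: "F \<in> faces \<C>" "U \<inter> side C b \<inter> side D b' \<subseteq> F"
  shows "s b' \<in> border F"
proof -
  have "C \<inter> U \<inter> side D b' \<noteq> {}" by (rule branchesD(9)[OF br])
  then have "s b' \<inter> frontier F \<noteq> {}"
    using branch_frontier[OF C br F] s by blast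
  then show ?thesis
    using frontier_segment[OF F(1) C] s F C unfolding border_def by blast
qed

lemma segments_corner:
  assumes C: "C \<in> \<C>" "D \<in> \<C>" "C \<noteq> D" and c: "c \<in> segs C" "d \<in> segs D"
    and p: "p \<in> closure c \<inter> P" "p \<in> closure d \<inter> P"
  shows "\<exists>F. c \<in> border F \<and> d \<in> border F"
proof -
  have pCD: "p \<in> C" "p \<in> D" using segs(4) C c p by blast+
  obtain U where U: "branches C D p U" "branches D C p U" "P \<inter> U = {p}"
    "\<forall>X\<in>\<C>. X \<inter> U \<noteq> {} \<longrightarrow> X = C \<or> X = D"
    using nbhd[OF C pCD] by metis
  obtain s where s: "\<forall>b. s b \<in> segs C \<and> C \<inter> U \<inter> side D b \<subseteq> s b \<and> s b \<subseteq> side D b"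
      "{y \<in> segs C. p \<in> closure y} = {s True, s False}" "s True \<noteq> s False"
    by (rule segs_at[OF C U(1,3)])
  obtain t where t: "\<forall>b. t b \<in> segs D \<and> D \<inter> U \<inter> side C b \<subseteq> t b \<and> t b \<subseteq> side C b"
      "{y \<in> segs D. p \<in> closure y} = {t True, t False}" "t True \<noteq> t False"
    by (rule segs_at[OF C(2,1) C(3)[symmetric] U(2,3)])
  have "c \<in> {s True, s False}" "d \<in> {t True, t False}" using s(2) t(2) c p by blast+
  \<comment> \<open>The segment \<open>c\<close> is on side \<open>b'\<close> of \<open>D\<close>
    and \<open>d\<close> on side \<open>b\<close> of \<open>C\<close>, so both bound the quadrant
    with these two sides.\<close>
  then obtain b' b where b: "c = s b'" "d = t b" by blast
  obtain F where F: "F \<in> faces \<C>" "U \<inter> side C b \<inter> side D b' \<subseteq> F"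
    using quadrant_face[OF C(1,2) U(1,4)] by metis
  have "c \<in> border F" unfolding b by (rule segment_branch[OF s(1) U(1) C(1) F])
  moreover have "d \<in> border F" unfolding b
    by (rule segment_branch[OF t(1) U(2) C(2) F(1)]) (use F(2) in blast)
  ultimately show ?thesis by blast
qed

text \<open>The end \<open>p\<close> of \<open>c\<close> is in the closed frontier of
  \<open>F\<close>, so \<open>F\<close> fills a quadrant at \<open>p\<close>, and every quadrant is
  bounded by a branch of \<open>D\<close>.\<close>

lemma border_turn:
  assumes C: "C \<in> \<C>" "D \<in> \<C>" "C \<noteq> D" and c: "c \<in> segs C" "c \<in> border F"
    and p: "p \<in> closure c \<inter> P" "p \<in> D \<inter> P"
  shows "\<exists>d\<in>segs D. d \<in> border F \<and> p \<in> closure d \<inter> P"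
proof -
  have F: "F \<in> faces \<C>" "c \<subseteq> frontier F" using c(2) unfolding border_def by auto
  have pCD: "p \<in> C" "p \<in> D" using segs(4) C c p by blast+
  obtain U where U: "branches C D p U" "branches D C p U" "P \<inter> U = {p}"
    "\<forall>X\<in>\<C>. X \<inter> U \<noteq> {} \<longrightarrow> X = C \<or> X = D"
    using nbhd[OF C pCD] by metis
  obtain t where t: "\<forall>b. t b \<in> segs D \<and> D \<inter> U \<inter> side C b \<subseteq> t b \<and> t b \<subseteq> side C b"
      "{y \<in> segs D. p \<in> closure y} = {t True, t False}" "t True \<noteq> t False"
    by (rule segs_at[OF C(2,1) C(3)[symmetric] U(2,3)])
  note oU = branchesD(1,2)[OF U(1)]
  have "p \<in> frontier F"
    using closure_minimal[OF F(2)] p by (auto simp: frontier_closed)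
  then have "F \<inter> U \<noteq> {}"
    using open_Int_closure_eq_empty[OF oU(1), of F] oU(2) unfolding frontier_def by blast
  then obtain b b' where "U \<inter> side C b \<inter> side D b' \<subseteq> F"
    using face_quadrant[OF C(1,2) U(1,4) F(1)] by metis
  then have "t b \<in> border F"
    using segment_branch[OF t(1) U(2) C(2) F(1), of b' b] by blast
  moreover have "p \<in> closure (t b)"
    using t(2) by (cases b) auto
  ultimately show ?thesis using t(1) p by blast
qed

sublocale curve_arrangement P \<C> "\<lambda>C. C \<inter> P" segs "\<lambda>e. closure e \<inter> P" border
proof
  show "finite P" "finite \<C>" "3 \<le> card \<C>" by (fact finite_crossings finite_curves card_curves)+
next
  fix C assume C: "C \<in> \<C>"
  show "finite (segs C)" by (rule finite_segs[OF C])
  show "C \<inter> P \<subseteq> P" by simp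
  fix e assume e: "e \<in> segs C"
  show "card (closure e \<inter> P) = 2" by (rule card_ends_seg[OF C e])
  show "closure e \<inter> P \<subseteq> C \<inter> P" using segs(4)[OF C e] by blast
next
  fix C D assume C: "C \<in> \<C>" "D \<in> \<C>" "C \<noteq> D"
  have "e \<notin> segs D" if "e \<in> segs C" for e
    using segs_disjoint(1)[OF C(1,2) that, of e] segs(2)[OF C(1) that] C(3) by auto
  then show "segs C \<inter> segs D = {}" by blast
next
  fix C p assume "C \<in> \<C>" "p \<in> C \<inter> P"
  then have "card {e \<in> segs C. p \<in> closure e} = 2" "p \<in> P" using degree_two by blast+
  then show "card {e \<in> segs C. p \<in> closure e \<inter> P} = 2" by simp
next
  fix p assume p: "p \<in> P"
  then obtain C D where C: "C \<in> \<C>" "D \<in> \<C>" "C \<noteq> D" "p \<in> C" "p \<in> D"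
    unfolding crossings_def by blast
  then have "{C \<in> \<C>. p \<in> C \<inter> P} = {C, D}" using only_two_curves[OF C] p by blast
  then show "card {C \<in> \<C>. p \<in> C \<inter> P} = 2" using C by simp
next
  fix C D assume C: "C \<in> \<C>" "D \<in> \<C>" "C \<noteq> D"
  have "C \<inter> P \<inter> (D \<inter> P) = C \<inter> D" using crossingI[OF C] by blast
  then show "even (card (C \<inter> P \<inter> (D \<inter> P)))" using even_common_crossings[OF C] by simp
next
  fix C X assume "C \<in> \<C>" "X \<subseteq> segs C" "X \<noteq> {}"
    "\<And>p e e'. e \<in> X \<Longrightarrow> e' \<in> segs C \<Longrightarrow> p \<in> closure e \<inter> P \<Longrightarrow> p \<in> closure e' \<inter> P \<Longrightarrow> e' \<in> X"
  then show "X = segs C" using segs_connected by metis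
next
  fix X assume X: "X \<subseteq> \<C>" "X \<noteq> {}" "X \<noteq> \<C>"
  then obtain C D p where C: "C \<in> X" "D \<in> \<C> - X" "p \<in> C" "p \<in> D" using curves_meet by blast
  then have "p \<in> P" using crossingI[of C D p] X by blast
  then show "\<exists>C\<in>X. \<exists>D\<in>\<C> - X. C \<inter> P \<inter> (D \<inter> P) \<noteq> {}" using C by blast
next
  fix C D c d p assume "C \<in> \<C>" "D \<in> \<C>" "C \<noteq> D" "c \<in> segs C" "d \<in> segs D"
    "p \<in> closure c \<inter> P" "p \<in> closure d \<inter> P"
  then show "\<exists>F. c \<in> border F \<and> d \<in> border F" by (rule segments_corner)
next
  fix F show "border F \<subseteq> \<Union>(segs ` \<C>)" unfolding border_def by blast
next
  fix C D c F p assume "C \<in> \<C>" "D \<in> \<C>" "C \<noteq> D" "c \<in> segs C" "c \<in> border F"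
    "p \<in> closure c \<inter> P" "p \<in> D \<inter> P"
  then show "\<exists>d\<in>segs D. d \<in> border F \<and> p \<in> closure d \<inter> P" by (rule border_turn)
next
  fix C e e' F assume "C \<in> \<C>" "e \<in> segs C" "e' \<in> segs C" "e \<in> border F" "e' \<in> border F"
  then show "e = e'" using frontier_one_segment unfolding border_def by blast
qed

end

section \<open>Vertex connectivity\<close>

lemma connected_iff_rtrancl_on:
  "Digraph_Component.connected G \<longleftrightarrow> verts G \<noteq> {} \<and>
     (\<forall>u\<in>verts G. \<forall>v\<in>verts G. (u, v) \<in> rtrancl_on (verts G)
        (\<Union>e\<in>arcs G. {(tail G e, head G e), (head G e, tail G e)}))"
  unfolding Digraph_Component.connected_def strongly_connected_def reachable_def
  by (simp add: parcs_mk_symmetric arcs_ends_def)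

lemma disconnected_separation:
  assumes "\<not> Digraph_Component.connected G" "verts G \<noteq> {}"
  obtains A B where "verts G = A \<union> B" "A \<inter> B = {}" "A \<noteq> {}" "B \<noteq> {}"
    "\<forall>e\<in>arcs G. tail G e \<in> A \<longrightarrow> head G e \<notin> B"
proof -
  define R where "R = (\<Union>e\<in>arcs G. {(tail G e, head G e), (head G e, tail G e)})"
  obtain u v where uv: "u \<in> verts G" "v \<in> verts G" "(u, v) \<notin> rtrancl_on (verts G) R"
    using assms unfolding connected_iff_rtrancl_on R_def by blast
  define A where "A = {w \<in> verts G. (u, w) \<in> rtrancl_on (verts G) R}"
  have "u \<in> A" using uv unfolding A_def by simp
  moreover have "v \<in> verts G - A" using uv unfolding A_def by blast
  moreover have "head G e \<notin> verts G - A" if "e \<in> arcs G" "tail G e \<in> A" for e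
  proof
    assume h: "head G e \<in> verts G - A"
    have "(tail G e, head G e) \<in> R" using that unfolding R_def by blast
    then have "(u, head G e) \<in> rtrancl_on (verts G) R"
      using that h rtrancl_on_into_rtrancl_on unfolding A_def by fast
    then show False using h unfolding A_def by blast
  qed
  moreover have "A \<subseteq> verts G" unfolding A_def by blast
  ultimately show thesis using that[of A "verts G - A"] by blast
qed

lemma isolated_not_connected:
  assumes "v \<in> verts G" "w \<in> verts G" "w \<noteq> v"
    and isolated: "\<And>e. e \<in> arcs G \<Longrightarrow> tail G e = v \<longleftrightarrow> head G e = v"
  shows "\<not> Digraph_Component.connected G"
proof
  define R where "R = (\<Union>e\<in>arcs G. {(tail G e, head G e), (head G e, tail G e)})"
  assume "Digraph_Component.connected G"
  then have "(v, w) \<in> rtrancl_on (verts G) R"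
    using assms(1,2) unfolding connected_iff_rtrancl_on R_def by blast
  then have "w = v"
  proof (induction rule: rtrancl_on_induct)
    case (step y z)
    then show ?case using isolated unfolding R_def by auto
  qed simp
  then show False using assms by simp
qed

section \<open>Lower and upper bound for the connectivity\<close>

context V_curves
begin

lemma segments_segs: "segments \<C> = \<Union>(segs ` \<C>)"
  unfolding segments_def segs_def ..

lemma small_deletion_connected:
  assumes S: "S \<subseteq> P" "card S \<le> 3"
  shows "Digraph_Component.connected (curve_graph \<C> \<restriction> (P - S))" "\<not> P - S \<subseteq> {v}"
proof -
  show big: "\<not> P - S \<subseteq> {v}" for v
  proof
    assume "P - S \<subseteq> {v}"
    then have "card P \<le> card (insert v S)"
      using finite_subset[OF S(1) finite_crossings] by (intro card_mono) auto
    also have "\<dots> \<le> 4" using S card_insert_le_m1[of 4 S v] by simp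
    finally show False using five_vertices by simp
  qed
  show "Digraph_Component.connected (curve_graph \<C> \<restriction> (P - S))" (is "Digraph_Component.connected ?G")
  proof (rule ccontr)
    assume "\<not> Digraph_Component.connected ?G"
    moreover have verts: "verts ?G = P - S" by simp
    moreover have "P - S \<noteq> {}" using big by blast
    ultimately obtain A B where AB: "P - S = A \<union> B" "A \<inter> B = {}" "A \<noteq> {}" "B \<noteq> {}"
      and arcs: "\<forall>e\<in>arcs ?G. tail ?G e \<in> A \<longrightarrow> head ?G e \<notin> B"
      by (metis disconnected_separation)
    have "(closure e \<inter> P) \<inter> B = {}" if C: "C \<in> \<C>" and e: "e \<in> segs C" and A: "(closure e \<inter> P) \<inter> A \<noteq> {}" for C e
    proof (rule ccontr)
      assume "(closure e \<inter> P) \<inter> B \<noteq> {}"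
      then obtain a b where ab: "a \<in> A" "b \<in> B" "{a, b} \<subseteq> closure e \<inter> P"
        using A by blast
      moreover have "a \<noteq> b" using ab AB by blast
      ultimately have "closure e \<inter> P = {a, b}"
        using card_ends_seg[OF C e] card_subset_eq[of "closure e \<inter> P" "{a, b}"] finite_crossings by simp
      then have "(a, e, b) \<in> arcs ?G"
        using C e ab AB unfolding curve_graph_def induce_subgraph_def segments_segs by auto
      then show False
        using arcs ab unfolding curve_graph_def induce_subgraph_def by fastforce
    qed
    then show False using no_small_separation[OF S AB] by blast
  qed
qed

text \<open>Four segments leave a crossing, two on each curve. Neighbours might coincide, or be all
  other vertices, so only \<open>card N \<le> 4\<close> and a disjunction are claimed; the lower
  bound later makes the number exact.\<close>

lemma neighbours_separate:
  obtains N where "N \<subseteq> P" "card N \<le> 4"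
    "\<not> Digraph_Component.connected (curve_graph \<C> \<restriction> (P - N)) \<or> (\<exists>v. P - N \<subseteq> {v})"
proof -
  obtain v where v: "v \<in> P" using five_vertices by fastforce
  then obtain C D where C: "C \<in> \<C>" "D \<in> \<C>" "C \<noteq> D" "v \<in> C" "v \<in> D"
    unfolding crossings_def by blast
  define I where "I = {e \<in> segs C. v \<in> closure e} \<union> {e \<in> segs D. v \<in> closure e}"
  define N where "N = (\<Union>e\<in>I. closure e \<inter> P - {v})"
  have deg: "card {e \<in> segs C. v \<in> closure e} = 2" "card {e \<in> segs D. v \<in> closure e} = 2"
    using degree_two C v by blast+
  have I: "finite I" "card I \<le> 4"
  proof -
    show "finite I" unfolding I_def using finite_segs C by simp
    show "card I \<le> 4" unfolding I_def using card_Un_le[of "{e \<in> segs C. v \<in> closure e}" "{e \<in> segs D. v \<in> closure e}"] deg by simp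
  qed
  have in_I: "e \<in> I" if "e \<in> segments \<C>" "v \<in> closure e" for e
  proof -
    obtain X where X: "X \<in> \<C>" "e \<in> segs X" using \<open>e \<in> segments \<C>\<close> unfolding segments_segs by blast
    then have "v \<in> X" using segs(4) that(2) by blast
    then have "X = C \<or> X = D" using only_two_curves[OF C X(1)] by blast
    then show ?thesis using X that(2) unfolding I_def by blast
  qed
  have "card (closure e \<inter> P - {v}) = 1" if "e \<in> I" for e
  proof -
    have "card (closure e \<inter> P) = 2" using that card_ends_seg C unfolding I_def by blast
    moreover have "v \<in> closure e \<inter> P" using that v unfolding I_def by blast
    ultimately show ?thesis by simp
  qed
  then have "(\<Sum>e\<in>I. card (closure e \<inter> P - {v})) = card I" by simp
  then have "card N \<le> 4"
    unfolding N_def using card_UN_le[OF I(1), of "\<lambda>e. closure e \<inter> P - {v}"] I(2) by linarith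
  moreover have "N \<subseteq> P" unfolding N_def by blast
  moreover have "\<not> Digraph_Component.connected (curve_graph \<C> \<restriction> (P - N))" if big: "\<not> P - N \<subseteq> {v}"
  proof -
    obtain w where w: "w \<in> P - N" "w \<noteq> v" using big by blast
    have vN: "v \<notin> N" unfolding N_def by blast
    have loop: "b = v" if e: "e \<in> segments \<C>" "closure e \<inter> P = {v, b}" and b: "b \<notin> N" for e b
    proof (rule ccontr)
      assume "b \<noteq> v"
      have "e \<in> I" using in_I e by blast
      then have "b \<in> N" using e(2) \<open>b \<noteq> v\<close> unfolding N_def by blast
      then show False using b by simp
    qed
    show ?thesis
    proof (rule isolated_not_connected[of v _ w])
      fix x assume x: "x \<in> arcs (curve_graph \<C> \<restriction> (P - N))"
      obtain a e b where [simp]: "x = (a, e, b)" by (cases x)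
      have "e \<in> segments \<C>" "closure e \<inter> P = {a, b}" "a \<notin> N" "b \<notin> N"
        using x unfolding curve_graph_def induce_subgraph_def by auto
      then have "a = v \<longleftrightarrow> b = v"
        using loop[of e a] loop[of e b] by (auto simp: insert_commute)
      then show "tail (curve_graph \<C> \<restriction> (P - N)) x = v \<longleftrightarrow> head (curve_graph \<C> \<restriction> (P - N)) x = v"
        unfolding curve_graph_def induce_subgraph_def by simp
    qed (use v vN w in auto)
  qed
  ultimately show thesis using that by blast
qed

lemma vertex_connectivity_four: "vertex_connectivity (curve_graph \<C>) = 4"
  unfolding vertex_connectivity_def
proof (rule Least_equality)
  have verts: "verts (curve_graph \<C>) = P" by (simp add: curve_graph_def)
  show lower: "4 \<le> k" if "\<exists>S\<subseteq>verts (curve_graph \<C>). finite S \<and> card S = k \<and>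
      (\<not> Digraph_Component.connected (curve_graph \<C> \<restriction> (verts (curve_graph \<C>) - S)) \<or>
       (\<exists>v. verts (curve_graph \<C>) - S \<subseteq> {v}))" for k
    using that small_deletion_connected unfolding verts by (metis Suc_leI eval_nat_numeral(2) not_less_eq_eq semiring_norm(26,27))
  obtain N where N: "N \<subseteq> P" "card N \<le> 4"
    "\<not> Digraph_Component.connected (curve_graph \<C> \<restriction> (P - N)) \<or> (\<exists>v. P - N \<subseteq> {v})"
    by (rule neighbours_separate)
  then have "\<not> card N \<le> 3"
    using small_deletion_connected[of N] by blast
  then have "card N = 4" using N by simp
  then show "\<exists>S\<subseteq>verts (curve_graph \<C>). finite S \<and> card S = 4 \<and>
      (\<not> Digraph_Component.connected (curve_graph \<C> \<restriction> (verts (curve_graph \<C>) - S)) \<or>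
       (\<exists>v. verts (curve_graph \<C>) - S \<subseteq> {v}))"
    using N finite_subset[OF N(1) finite_crossings] unfolding verts by blast
qed

end

theorem theorem2:
  fixes G :: "(complex, complex \<times> complex set \<times> complex) pre_digraph"
  assumes "V_graph G"
  shows "vertex_connectivity G = 4"
proof -
  obtain \<C> where C: "curve_system \<C>" "unique_face_incidence \<C>" "G = curve_graph \<C>"
    using assms unfolding V_graph_def by blast
  interpret V_curves \<C>
    using C by unfold_locales
  show ?thesis
    using vertex_connectivity_four C by simp
qed

end
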